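(* Let $k\ge 0$. Assume that the initial condition $v_0$ is $1$-periodic and of class $C^{k+1}$, and that $b$ is $1$-periodic and of class $C^{2k+2}$. Let $v$ be the exact solution of $v_t+b(x)v_x=0$, $v(0,\cdot)=v_0$, with periodic boundary conditions on $(0,1)$, let $v^n:=v(t_n,\cdot)$, and let $u^0=\Pi v_0$, $u^{n+1}=\widetilde{\mathcal T}_{b,\Delta t}u^n$ be the fully discrete semi-Lagrangian discontinuous Galerkin scheme. Then there exist constants $C_1\ge 0$ and $C\ge 0$, independent of $\Delta t$, $\Delta x$ and $n$, such that $$\|u^n-v^n\|_{L^2}\le e^{C_1T}\Big(\|v^0-u^0\|_{L^2}+C\,T\,\frac{\Delta x^{k+1}}{\Delta t}\Big),\qquad \forall\, 0\le n\le N.$$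
   Context: Setting. $\Omega=(0,1)$; functions on $\Omega$ are identified with their $1$-periodic extensions to $\mathbb R$. $L^2=L^2(\Omega)$ with inner product $(\cdot,\cdot)$ and norm $\|\cdot\|_{L^2}$. $T>0$, $N\ge1$ integer, $\Delta t=T/N$, $t_n=n\Delta t$. $M\ge 1$ integer, $\Delta x=1/M$, cells $I_i=(i\Delta x,(i+1)\Delta x)$, $i=0,\dots,M-1$. $V_k=\{v\in L^2(\Omega): v|_{I_i}\text{ is a polynomial of degree}\le k,\ \forall i\}$. $\Pi$ is the $L^2$-orthogonal projection onto $V_k$. Characteristics. For $x\in\mathbb R$, $t\mapsto y_x(t)$ is the solution of $\dot y(t)=b(y(t))$, $t\in\mathbb R$, $y(0)=x$. The exact solution satisfies $v(t,x)=v_0(y_x(-t))$. Quadrature. $\{x_\alpha\}_{\alpha=0}^k\subset(-1,1)$ and weights $w_\alpha>0$ are the $(k+1)$-point Gauss–Legendre rule on $(-1,1)$ (exact for polynomials of degree $\le 2k+1$). For each $i$, let $x_{i,1}<\dots<x_{i,p_i}$ be the (finitely many) points $x\in I_i$ such that $y_x(-\Delta t)\in\Delta x\,\mathbb Z$ (i.e. is a mesh node), and $x_{i,0}=i\Delta x$, $x_{i,p_i+1}=(i+1)\Delta x$. Set $\tilde w^i_{q,\alpha}=\frac{w_\alpha}{2}(x_{i,q+1}-x_{i,q})$ and $\tilde x^i_{q,\alpha}=\frac{x_{i,q}+x_{i,q+1}}2+x_\alpha\frac{x_{i,q+1}-x_{i,q}}2$, and $$(f,g)_G:=\sum_{i=0}^{M-1}\sum_{q=0}^{p_i}\sum_{\alpha=0}^k\tilde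 w^i_{q,\alpha}\,f(\tilde x^i_{q,\alpha})\,g(\tilde x^i_{q,\alpha}).$$ Scheme. $\widetilde{\mathcal T}_{b,\Delta t}u$ is the unique element of $V_k$ with $(\widetilde{\mathcal T}_{b,\Delta t}u,\varphi)=(u(y_\cdot(-\Delta t)),\varphi)_G$ for all $\varphi\in V_k$. *)

theory Defs
  imports "HOL-Analysis.Analysis" "HOL-Computational_Algebra.Polynomial"
begin

definition periodic1 :: "(real \<Rightarrow> real) \<Rightarrow> bool" where
  "periodic1 f \<longleftrightarrow> (\<forall>x. f (x + 1) = f x)"

definition C_class :: "nat \<Rightarrow> (real \<Rightarrow> real) \<Rightarrow> bool" where
  "C_class m f \<longleftrightarrow>
     (\<forall>j<m. \<forall>x. (deriv ^^ j) f differentiable (at x)) \<and>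
     continuous_on UNIV ((deriv ^^ m) f)"

text \<open>The space \<open>L\<^sup>2(0,1)\<close> is handled through representatives.\<close>

definition L2_inner :: "(real \<Rightarrow> real) \<Rightarrow> (real \<Rightarrow> real) \<Rightarrow> real" where
  "L2_inner f g = (LINT x:{0<..<1}|lborel. f x * g x)"

definition L2_norm :: "(real \<Rightarrow> real) \<Rightarrow> real" where
  "L2_norm f = sqrt (L2_inner f f)"

text \<open>The discontinuous Galerkin space \<open>V\<^sub>k\<close> on the uniform mesh with \<open>M\<close> cells
  (\<open>\<Delta>x = 1/M\<close>).  An element of \<open>V\<^sub>k\<close> is only determined almost everywhere; it is represented
  by its \<open>1\<close>-periodic extension that is right-continuous at the mesh nodes.  This makes the
  representative unique, and node values enter neither the \<open>L\<^sup>2\<close> products nor the quadrature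
  (no quadrature point, and no foot of a characteristic from one, is a mesh node).\<close>

definition DG_space :: "nat \<Rightarrow> nat \<Rightarrow> (real \<Rightarrow> real) set" where
  "DG_space k M = {u. periodic1 u \<and>
     (\<forall>i<M. \<exists>p :: real poly. degree p \<le> k \<and>
        (\<forall>x\<in>{real i / real M ..< real (Suc i) / real M}. u x = poly p x))}"

definition DG_proj :: "nat \<Rightarrow> nat \<Rightarrow> (real \<Rightarrow> real) \<Rightarrow> (real \<Rightarrow> real)" where
  "DG_proj k M f =
     (THE u. u \<in> DG_space k M \<and>
        (\<forall>\<phi>\<in>DG_space k M. L2_inner (\<lambda>x. f x - u x) \<phi> = 0))"

text \<open>\<open>y x t\<close> is the position at time \<open>t\<close> of the characteristic starting at \<open>x\<close>.\<close>

definition characteristics :: "(real \<Rightarrow> real) \<Rightarrow> (real \<Rightarrow> real \<Rightarrow> real) \<Rightarrow> bool" where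
  "characteristics b y \<longleftrightarrow>
     (\<forall>x. y x 0 = x \<and> (\<forall>t. (y x has_real_derivative b (y x t)) (at t)))"

text \<open>Classical solution \<open>v t x\<close> of \<open>v\<^sub>t + b v\<^sub>x = 0\<close> on \<open>[0,T]\<close>, periodic in \<open>x\<close>
  (at the end points of \<open>[0,T]\<close> the time derivative is one-sided).\<close>

definition transport_solution ::
  "(real \<Rightarrow> real) \<Rightarrow> (real \<Rightarrow> real) \<Rightarrow> real \<Rightarrow> (real \<Rightarrow> real \<Rightarrow> real) \<Rightarrow> bool" where
  "transport_solution b v0 T v \<longleftrightarrow>
     (\<forall>x. v 0 x = v0 x) \<and>
     (\<forall>t\<in>{0..T}. periodic1 (v t)) \<and>
     (\<forall>t\<in>{0..T}. \<forall>x. \<exists>vt vx.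
        ((\<lambda>(s, z). v s z) has_derivative (\<lambda>(ds, dz). vt * ds + vx * dz))
          (at (t, x) within {0..T} \<times> UNIV) \<and>
        vt + b x * vx = 0)"

text \<open>The \<open>(k+1)\<close>-point Gauss--Legendre rule on \<open>(-1,1)\<close>: nodes \<open>\<xi> \<alpha>\<close>, weights \<open>w \<alpha>\<close>,
  \<open>\<alpha> = 0, \<dots>, k\<close>.  Exactness up to degree \<open>2k+1\<close> determines it up to the numbering of the nodes.\<close>

definition gauss_legendre :: "nat \<Rightarrow> (nat \<Rightarrow> real) \<Rightarrow> (nat \<Rightarrow> real) \<Rightarrow> bool" where
  "gauss_legendre k \<xi> w \<longleftrightarrow>
     inj_on \<xi> {..k} \<and>
     (\<forall>\<alpha>\<le>k. -1 < \<xi> \<alpha> \<and> \<xi> \<alpha> < 1 \<and> 0 < w \<alpha>) \<and>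
     (\<forall>p :: real poly. degree p \<le> 2 * k + 1 \<longrightarrow>
        (\<Sum>\<alpha>\<le>k. w \<alpha> * poly p (\<xi> \<alpha>)) = (LINT x:{-1<..<1}|lborel. poly p x))"

text \<open>The points of the open cell \<open>I\<^sub>i\<close> whose characteristic, traced back over a time step \<open>\<tau>\<close>,
  ends at a mesh node.\<close>

definition node_preimages :: "(real \<Rightarrow> real \<Rightarrow> real) \<Rightarrow> real \<Rightarrow> nat \<Rightarrow> nat \<Rightarrow> real set" where
  "node_preimages y \<tau> M i =
     {x \<in> {real i / real M <..< real (Suc i) / real M}. \<exists>j :: int. y x (- \<tau>) = of_int j / real M}"

text \<open>The list \<open>[x\<^bsub>i,0\<^esub>, x\<^bsub>i,1\<^esub>, \<dots>, x\<^bsub>i,p+1\<^esub>]\<close>, with \<open>p = card (node_preimages y \<tau> M i)\<close>.\<close>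

definition breakpoints :: "(real \<Rightarrow> real \<Rightarrow> real) \<Rightarrow> real \<Rightarrow> nat \<Rightarrow> nat \<Rightarrow> real list" where
  "breakpoints y \<tau> M i =
     real i / real M # sorted_list_of_set (node_preimages y \<tau> M i) @ [real (Suc i) / real M]"

definition quad_weight :: "(nat \<Rightarrow> real) \<Rightarrow> real list \<Rightarrow> nat \<Rightarrow> nat \<Rightarrow> real" where
  "quad_weight w X q \<alpha> = w \<alpha> / 2 * (X ! Suc q - X ! q)"

definition quad_point :: "(nat \<Rightarrow> real) \<Rightarrow> real list \<Rightarrow> nat \<Rightarrow> nat \<Rightarrow> real" where
  "quad_point \<xi> X q \<alpha> = (X ! q + X ! Suc q) / 2 + \<xi> \<alpha> * ((X ! Suc q - X ! q) / 2)"

definition gauss_inner ::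
  "nat \<Rightarrow> (nat \<Rightarrow> real) \<Rightarrow> (nat \<Rightarrow> real) \<Rightarrow> (real \<Rightarrow> real \<Rightarrow> real) \<Rightarrow> real \<Rightarrow> nat \<Rightarrow>
   (real \<Rightarrow> real) \<Rightarrow> (real \<Rightarrow> real) \<Rightarrow> real" where
  "gauss_inner k \<xi> w y \<tau> M f g =
     (\<Sum>i<M. let X = breakpoints y \<tau> M i in
        \<Sum>q\<le>card (node_preimages y \<tau> M i). \<Sum>\<alpha>\<le>k.
          quad_weight w X q \<alpha> * f (quad_point \<xi> X q \<alpha>) * g (quad_point \<xi> X q \<alpha>))"

definition SL_step ::
  "nat \<Rightarrow> (nat \<Rightarrow> real) \<Rightarrow> (nat \<Rightarrow> real) \<Rightarrow> (real \<Rightarrow> real \<Rightarrow> real) \<Rightarrow> real \<Rightarrow> nat \<Rightarrow>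
   (real \<Rightarrow> real) \<Rightarrow> (real \<Rightarrow> real)" where
  "SL_step k \<xi> w y \<tau> M u =
     (THE u'. u' \<in> DG_space k M \<and>
        (\<forall>\<phi>\<in>DG_space k M.
           L2_inner u' \<phi> = gauss_inner k \<xi> w y \<tau> M (\<lambda>x. u (y x (- \<tau>))) \<phi>))"

definition SLDG_scheme ::
  "nat \<Rightarrow> (nat \<Rightarrow> real) \<Rightarrow> (nat \<Rightarrow> real) \<Rightarrow> (real \<Rightarrow> real \<Rightarrow> real) \<Rightarrow> real \<Rightarrow> nat \<Rightarrow>
   (real \<Rightarrow> real) \<Rightarrow> nat \<Rightarrow> (real \<Rightarrow> real)" where
  "SLDG_scheme k \<xi> w y \<tau> M v0 n = (SL_step k \<xi> w y \<tau> M ^^ n) (DG_proj k M v0)"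

end

(*
Stability. Testing the scheme with its own output and using that the quadrature is exact on V_k,
the new iterate is bounded by the discrete norm of u o Y, where Y is the flow map over one time
step backwards. On a subcell Y differs from the affine map with the same end values by
O(dt) times the length of the subcell, so replacing Y by that map changes the quadrature of the
square of u o Y only by a factor 1 + O(dt), by an inverse estimate for polynomials of degree k;
after the replacement the quadrature is exact, and the images of the subcells tile one period.

Consistency. Comparing with piecewise Taylor polynomials of the exact solution costs
O(dx^(k+1)) per step. Their remainders are uniform in time because the flow is C^(k+1) in the
starting point with jointly continuous derivatives: its first derivative is the exponential of
the time integral of b' along the flow, which gives smoothness by induction.
*)
theory Submission
  imports Defs
begin

text \<open>The quadrature sees point values only, and outside \<open>DG_space\<close> its norm can
  differ from the L2 norm. So u^n - v^n itself is not propagated. At each time level v^n is replaced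
  by some P^n in the discrete space within eps = B dx^(k+1) of it at every point, and u^n - P^n, for
  which both norms agree, is propagated. Because v^n o Y = v^(n+1), the defect P^n o Y - P^(n+1) is
  at most 2 eps pointwise, hence also in the discrete norm; N such defects give 2 N eps = 2 T eps /
  dt, the source of the quotient dx^(k+1) / dt. The step dt may be large compared with dx. Cutting
  the cells at the preimages of the nodes makes the numerical solution one polynomial on the image
  of each subcell, whatever dt is, and the growth per step is bounded by exp(\<sigma> dt) for every
  dt up to T, at the price of exp(2 L T) inside \<sigma>. Passing between v and P at the initial and
  at the final time costs a factor sqrt 2 each. The resulting factor 2 is moved into the exponential
  by adding ln 2 / T to the rate.\<close>

section \<open>Elementary properties of the class C^m\<close>

lemma C_class_Suc:
  assumes "C_class (Suc m) f"
  shows "f differentiable (at x)" and "C_class m (deriv f)"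
  using assms unfolding C_class_def
  by (force simp: funpow_Suc_right simp del: funpow.simps)+

lemma C_class_DERIV: "C_class (Suc m) f \<Longrightarrow> (f has_real_derivative deriv f x) (at x)"
  using C_class_Suc(1) DERIV_deriv_iff_real_differentiable by blast

lemma C_class_continuous: "C_class m f \<Longrightarrow> continuous_on UNIV f"
proof (cases m)
  case 0
  then show "C_class m f \<Longrightarrow> continuous_on UNIV f" by (simp add: C_class_def)
next
  case (Suc n)
  then show "C_class m f \<Longrightarrow> continuous_on UNIV f"
    by (metis C_class_DERIV DERIV_isCont continuous_at_imp_continuous_on)
qed

lemma C_class_SucD: "C_class (Suc m) f \<Longrightarrow> C_class m f"
proof (induction m arbitrary: f)
  case 0
  then show ?case by (simp add: C_class_continuous C_class_def[of 0])
next
  case (Suc m)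
  show ?case
    unfolding C_class_def
  proof (intro conjI allI impI)
    show "(deriv ^^ j) f differentiable (at x)" if "j < Suc m" for j x
      using Suc.prems that unfolding C_class_def by auto
    have "(deriv ^^ Suc m) f differentiable (at x)" for x
      using Suc.prems unfolding C_class_def by blast
    then show "continuous_on UNIV ((deriv ^^ Suc m) f)"
      by (simp add: continuous_at_imp_continuous_on differentiable_imp_continuous_within)
  qed
qed

lemma C_class_mono: "C_class m f \<Longrightarrow> n \<le> m \<Longrightarrow> C_class n f"
  by (induction m) (auto simp: le_Suc_eq dest: C_class_SucD)

section \<open>Functions smooth in a variable and jointly continuous with a parameter\<close>

text \<open>The first argument t is a parameter, the second carries the m derivatives, each jointly
  continuous in (t, x). Asking for some derivative g instead of naming \<open>deriv\<close> lets the
  closure lemmas supply explicit formulas.\<close>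

primrec param_C :: "nat \<Rightarrow> (real \<Rightarrow> real \<Rightarrow> real) \<Rightarrow> bool" where
  "param_C 0 f \<longleftrightarrow> continuous_on UNIV (\<lambda>p. f (fst p) (snd p))"
| "param_C (Suc m) f \<longleftrightarrow> continuous_on UNIV (\<lambda>p. f (fst p) (snd p)) \<and>
     (\<exists>g. param_C m g \<and> (\<forall>t x. (f t has_real_derivative g t x) (at x)))"

declare param_C.simps(2) [simp del]

lemma param_C_SucI:
  assumes "continuous_on UNIV (\<lambda>p. f (fst p) (snd p))" "param_C m g"
    "\<And>t x. (f t has_real_derivative g t x) (at x)"
  shows "param_C (Suc m) f"
  using assms unfolding param_C.simps(2) by blast

lemma param_C_SucE:
  assumes "param_C (Suc m) f"
  obtains g where "param_C m g" "\<And>t x. (f t has_real_derivative g t x) (at x)"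
  using assms unfolding param_C.simps(2) by blast

lemma param_C_continuous: "param_C m f \<Longrightarrow> continuous_on UNIV (\<lambda>p. f (fst p) (snd p))"
  by (cases m) (auto simp: param_C.simps(2))

lemma param_C_SucD: "param_C (Suc m) f \<Longrightarrow> param_C m f"
proof (induction m arbitrary: f)
  case (Suc m)
  from param_C_SucE[OF Suc.prems] obtain g
    where g: "param_C (Suc m) g" "\<And>t x. (f t has_real_derivative g t x) (at x)"
    by blast
  show ?case
    by (rule param_C_SucI[OF param_C_continuous[OF Suc.prems] Suc.IH[OF g(1)] g(2)])
qed (simp add: param_C.simps(2))

lemma param_C_add:
  "param_C m f \<Longrightarrow> param_C m g \<Longrightarrow> param_C m (\<lambda>t x. f t x + g t x)"
proof (induction m arbitrary: f g)
  case 0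
  then show ?case by (simp add: continuous_on_add)
next
  case (Suc m)
  obtain f' g' where f': "param_C m f'" "\<And>t x. (f t has_real_derivative f' t x) (at x)"
    and g': "param_C m g'" "\<And>t x. (g t has_real_derivative g' t x) (at x)"
    using Suc.prems by (meson param_C_SucE)
  show ?case
    by (rule param_C_SucI[OF _ Suc.IH[OF f'(1) g'(1)]])
      (intro continuous_on_add DERIV_add f'(2) g'(2) param_C_continuous[OF Suc.prems(1)]
        param_C_continuous[OF Suc.prems(2)])+
qed

lemma param_C_mult:
  "param_C m f \<Longrightarrow> param_C m g \<Longrightarrow> param_C m (\<lambda>t x. f t x * g t x)"
proof (induction m arbitrary: f g)
  case 0
  then show ?case by (simp add: continuous_on_mult)
next
  case (Suc m)
  obtain f' g' where f': "param_C m f'" "\<And>t x. (f t has_real_derivative f' t x) (at x)"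
    and g': "param_C m g'" "\<And>t x. (g t has_real_derivative g' t x) (at x)"
    using Suc.prems by (meson param_C_SucE)
  have "((\<lambda>x. f t x * g t x) has_real_derivative f' t x * g t x + g' t x * f t x) (at x)" for t x
    by (intro DERIV_mult f' g')
  moreover have "param_C m (\<lambda>t x. f' t x * g t x + g' t x * f t x)"
    by (intro param_C_add Suc.IH f'(1) g'(1) Suc.prems[THEN param_C_SucD])
  ultimately show ?case
    by (intro param_C_SucI continuous_on_mult param_C_continuous[OF Suc.prems(1)]
        param_C_continuous[OF Suc.prems(2)])
qed

lemma param_C_compose:
  "C_class m \<phi> \<Longrightarrow> param_C m f \<Longrightarrow> param_C m (\<lambda>t x. \<phi> (f t x))"
proof (induction m arbitrary: \<phi>)
  case 0
  then have "continuous_on UNIV \<phi>" by (simp add: C_class_def)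
  then show ?case
    using 0 continuous_on_compose2 by fastforce
next
  case (Suc m)
  obtain f' where f': "param_C m f'" "\<And>t x. (f t has_real_derivative f' t x) (at x)"
    using param_C_SucE[OF Suc.prems(2)] by metis
  have "((\<lambda>x. \<phi> (f t x)) has_real_derivative deriv \<phi> (f t x) * f' t x) (at x)" for t x
    using DERIV_chain2[OF C_class_DERIV[OF Suc.prems(1)] f'(2)] .
  moreover have "param_C m (\<lambda>t x. deriv \<phi> (f t x) * f' t x)"
    by (rule param_C_mult[OF Suc.IH[OF C_class_Suc(2)[OF Suc.prems(1)]
        param_C_SucD[OF Suc.prems(2)]] f'(1)])
  moreover have "continuous_on UNIV (\<lambda>p. \<phi> (f (fst p) (snd p)))"
    by (rule continuous_on_compose2[OF C_class_continuous[OF Suc.prems(1)]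
        param_C_continuous[OF Suc.prems(2)]]) simp
  ultimately show ?case by (intro param_C_SucI)
qed

lemma C_class_exp: "C_class m (exp :: real \<Rightarrow> real)"
proof -
  have "deriv (exp :: real \<Rightarrow> real) = exp"
    by (intro ext DERIV_imp_deriv DERIV_exp)
  then have "(deriv ^^ j) (exp :: real \<Rightarrow> real) = exp" for j
    by (induction j) auto
  then show ?thesis
    unfolding C_class_def
    by (auto intro!: continuous_intros simp: real_differentiable_def intro!: exI DERIV_exp)
qed

lemma continuous_on_param_integrand:
  fixes f :: "real \<Rightarrow> real \<Rightarrow> real"
  assumes "continuous_on UNIV (\<lambda>p. f (fst p) (snd p))" "continuous_on A g" "continuous_on A h"
  shows "continuous_on A (\<lambda>p. f (g p) (h p))"
  using continuous_on_compose2[OF assms(1) continuous_on_Pair[OF assms(2,3)]] by simp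

text \<open>This is the integral of f over [0, t] after the substitution r = s t. The fixed range
  [0, 1] admits differentiation under the integral sign, covers negative t, and leaves t as an
  ordinary continuous parameter.\<close>

lemma param_C_integral:
  "param_C m f \<Longrightarrow> param_C m (\<lambda>t x. integral {0..1} (\<lambda>s. t * f (s * t) x))"
proof (induction m arbitrary: f)
  case 0
  have "continuous_on UNIV (\<lambda>p. integral (cbox 0 1) (\<lambda>s. fst p * f (s * fst p) (snd p)))"
    using 0 by (intro integral_continuous_on_param)
      (auto simp: split_beta intro!: continuous_intros continuous_on_param_integrand[of f])
  then show ?case by simp
next
  case (Suc m)
  obtain g where g: "param_C m g" "\<And>t x. (f t has_real_derivative g t x) (at x)"
    using param_C_SucE[OF Suc.prems] by metis
  note cf = param_C_continuous[OF Suc.prems] and cg = param_C_continuous[OF g(1)]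
  have "((\<lambda>x. integral (cbox 0 1) (\<lambda>s. t * f (s * t) x)) has_real_derivative
      integral (cbox 0 1) (\<lambda>s. t * g (s * t) x)) (at x within UNIV)" for t x
  proof (rule leibniz_rule_field_derivative)
    show "((\<lambda>x. t * f (s * t) x) has_real_derivative t * g (s * t) x) (at x within UNIV)" for x s
      using g(2) by (auto intro!: derivative_eq_intros)
    show "(\<lambda>s. t * f (s * t) x) integrable_on cbox 0 1" for x
      by (intro integrable_continuous continuous_intros continuous_on_param_integrand[OF cf])
    show "continuous_on (UNIV \<times> cbox 0 1) (\<lambda>(x, s). t * g (s * t) x)"
      by (auto simp: split_beta intro!: continuous_intros continuous_on_param_integrand[OF cg])
  qed auto
  moreover have "continuous_on UNIV (\<lambda>p. integral (cbox 0 1) (\<lambda>s. fst p * f (s * fst p) (snd p)))"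
    by (intro integral_continuous_on_param)
      (auto simp: split_beta intro!: continuous_intros continuous_on_param_integrand[OF cf])
  ultimately show ?case
    using Suc.IH[OF g(1)] by (auto intro!: param_C_SucI)
qed

text \<open>Taylor's theorem by induction instead of a remainder formula: expand the derivative g,
  integrate the expansion term by term, and let the mean value inequality on the segment from c to x
  supply one more factor |x - c|. Compactness enters for m = 0, and the same B survives every step,
  so it serves all t and c.\<close>

lemma param_C_local_poly:
  assumes "param_C m f"
  shows "\<exists>B\<ge>0. \<forall>t\<in>{t0..t1}. \<forall>c\<in>{0..1}. \<exists>a. \<forall>x\<in>{0..1}.
           \<bar>f t x - (\<Sum>j<m. a j * (x - c) ^ j)\<bar> \<le> B * \<bar>x - c\<bar> ^ m"
  using assms
proof (induction m arbitrary: f)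
  case 0
  have "compact ((\<lambda>p. f (fst p) (snd p)) ` ({t0..t1} \<times> {0..1}))"
    using 0 by (intro compact_continuous_image compact_Times) (auto intro: continuous_on_subset)
  then obtain B where "\<forall>r\<in>(\<lambda>p. f (fst p) (snd p)) ` ({t0..t1} \<times> {0..1}). norm r \<le> B"
    using compact_imp_bounded bounded_iff by metis
  then have "\<bar>f t x\<bar> \<le> max B 0" if "t \<in> {t0..t1}" "x \<in> {0..1}" for t x
    using that by (force simp: le_max_iff_disj)
  then show ?case
    by (intro exI[of _ "max B 0"]) auto
next
  case (Suc m)
  obtain g where g: "param_C m g" "\<And>t x. (f t has_real_derivative g t x) (at x)"
    using param_C_SucE[OF Suc.prems] by metis
  obtain B where B: "B \<ge> 0" "\<And>t c. t \<in> {t0..t1} \<Longrightarrow> c \<in> {0..1} \<Longrightarrow> \<exists>a. \<forall>x\<in>{0..1}.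
           \<bar>g t x - (\<Sum>j<m. a j * (x - c) ^ j)\<bar> \<le> B * \<bar>x - c\<bar> ^ m"
    using Suc.IH[OF g(1)] by blast
  have "\<exists>a. \<forall>x\<in>{0..1}. \<bar>f t x - (\<Sum>j<Suc m. a j * (x - c) ^ j)\<bar> \<le> B * \<bar>x - c\<bar> ^ Suc m"
    if t: "t \<in> {t0..t1}" and c: "c \<in> {0..1}" for t c
  proof -
    obtain a where a: "\<And>x. x\<in>{0..1} \<Longrightarrow> \<bar>g t x - (\<Sum>j<m. a j * (x - c) ^ j)\<bar> \<le> B * \<bar>x - c\<bar> ^ m"
      using B(2)[OF t c] by blast
    \<comment> \<open>Antiderivative of the expansion of g; the constant term \<open>f t c\<close>
      makes the remainder \<open>h\<close> vanish at c.\<close>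
    define a' where "a' j = (case j of 0 \<Rightarrow> f t c | Suc i \<Rightarrow> a i / real (Suc i))" for j
    define h where "h x = f t x - (\<Sum>j<Suc m. a' j * (x - c) ^ j)" for x
    have h_eq: "h x = f t x - f t c - (\<Sum>j<m. a j / real (Suc j) * (x - c) ^ Suc j)" for x
      unfolding h_def sum.lessThan_Suc_shift by (simp add: a'_def)
    have dh: "(h has_real_derivative g t x - (\<Sum>j<m. a j * (x - c) ^ j)) (at x)" for x
    proof -
      have *: "((\<lambda>x. a j / real (Suc j) * (x - c) ^ Suc j) has_real_derivative a j * (x - c) ^ j) (at x)" for j
        by (rule derivative_eq_intros refl)+ (simp add: field_simps del: of_nat_Suc)
      show ?thesis
        unfolding h_eq by (rule derivative_eq_intros g(2) * refl)+ simp
    qed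
    have "\<bar>h x\<bar> \<le> B * \<bar>x - c\<bar> ^ Suc m" if x: "x \<in> {0..1}" for x
    proof -
      have "norm (h x - h c) \<le> B * \<bar>x - c\<bar> ^ m * norm (x - c)"
      proof (rule field_differentiable_bound[of "closed_segment c x"])
        fix z assume z: "z \<in> closed_segment c x"
        then have z': "z \<in> {0..1}" "\<bar>z - c\<bar> \<le> \<bar>x - c\<bar>"
          using x c by (auto simp: closed_segment_eq_real_ivl split: if_splits)
        show "(h has_field_derivative g t z - (\<Sum>j<m. a j * (z - c) ^ j)) (at z within closed_segment c x)"
          using dh has_field_derivative_at_within by blast
        have "B * \<bar>z - c\<bar> ^ m \<le> B * \<bar>x - c\<bar> ^ m"
          using z'(2) B(1) by (intro mult_left_mono power_mono) auto
        then show "norm (g t z - (\<Sum>j<m. a j * (z - c) ^ j)) \<le> B * \<bar>x - c\<bar> ^ m"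
          using a[OF z'(1)] by simp
      qed auto
      moreover have "h c = 0" unfolding h_eq by simp
      ultimately show ?thesis by (simp add: mult_ac)
    qed
    then show ?thesis unfolding h_def by blast
  qed
  then show ?case using B(1) by blast
qed

lemma param_C_local_polynomial:
  assumes "param_C (Suc k) f"
  shows "\<exists>B\<ge>0. \<forall>t\<in>{t0..t1}. \<forall>c\<in>{0..1}. \<exists>p. degree p \<le> k \<and> (\<forall>x\<in>{0..1}.
           \<bar>f t x - poly p x\<bar> \<le> B * \<bar>x - c\<bar> ^ Suc k)"
proof -
  obtain B where B: "B \<ge> 0" "\<And>t c. t \<in> {t0..t1} \<Longrightarrow> c \<in> {0..1} \<Longrightarrow> \<exists>a. \<forall>x\<in>{0..1}.
           \<bar>f t x - (\<Sum>j<Suc k. a j * (x - c) ^ j)\<bar> \<le> B * \<bar>x - c\<bar> ^ Suc k"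
    using param_C_local_poly[OF assms] by blast
  have "\<exists>p. degree p \<le> k \<and> (\<forall>x\<in>{0..1}. \<bar>f t x - poly p x\<bar> \<le> B * \<bar>x - c\<bar> ^ Suc k)"
    if tc: "t \<in> {t0..t1}" "c \<in> {0..1}" for t c
  proof -
    obtain a where a: "\<And>x. x\<in>{0..1} \<Longrightarrow> \<bar>f t x - (\<Sum>j<Suc k. a j * (x - c) ^ j)\<bar> \<le> B * \<bar>x - c\<bar> ^ Suc k"
      using B(2)[OF tc] by blast
    define p where "p = (\<Sum>j<Suc k. smult (a j) ([:- c, 1:] ^ j))"
    have "degree p \<le> k"
      unfolding p_def
    proof (rule degree_sum_le)
      fix j assume "j \<in> {..<Suc k}"
      then show "degree (smult (a j) ([:- c, 1:] ^ j)) \<le> k"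
        using degree_smult_le[of "a j" "[:- c, 1:] ^ j"] by (simp add: degree_linear_power)
    qed simp
    moreover have "poly p x = (\<Sum>j<Suc k. a j * (x - c) ^ j)" for x
      unfolding p_def by (simp add: poly_sum poly_power)
    ultimately show ?thesis using a by metis
  qed
  then show ?thesis using B(1) by blast
qed

section \<open>The flow of a Lipschitz vector field on the line\<close>

locale lipschitz_flow =
  fixes b b' :: "real \<Rightarrow> real" and y :: "real \<Rightarrow> real \<Rightarrow> real" and L :: real
  assumes b_deriv: "\<And>x. (b has_real_derivative b' x) (at x)"
    and b'_cont: "continuous_on UNIV b'"
    and b'_bound: "\<And>x. \<bar>b' x\<bar> \<le> L"
    and char: "characteristics b y"
begin

text \<open>The mean of b' over the segment from q to p: the divided difference of b, extended
  continuously to the diagonal. This continuity turns the difference of two trajectories into a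
  solution of a linear equation with continuous coefficient.\<close>

definition slope :: "real \<Rightarrow> real \<Rightarrow> real" where
  "slope p q = integral {0..1} (\<lambda>r. b' (q + r * (p - q)))"

lemma b'_continuous_compose [continuous_intros]:
  "continuous_on A f \<Longrightarrow> continuous_on A (\<lambda>x. b' (f x))"
  using continuous_on_compose2[OF b'_cont] by blast

lemma slope_eq: "b p - b q = (p - q) * slope p q"
proof -
  have "((\<lambda>r. (p - q) * b' (q + r * (p - q))) has_integral
      b (q + 1 * (p - q)) - b (q + 0 * (p - q))) {0..1}"
  proof (rule fundamental_theorem_of_calculus)
    fix r :: real
    have "((\<lambda>r. b (q + r * (p - q))) has_real_derivative b' (q + r * (p - q)) * (p - q)) (at r)"
      by (rule DERIV_chain2[OF b_deriv]) (auto intro!: derivative_eq_intros)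
    then show "((\<lambda>r. b (q + r * (p - q))) has_vector_derivative (p - q) * b' (q + r * (p - q)))
        (at r within {0..1})"
      by (simp add: has_real_derivative_iff_has_vector_derivative has_vector_derivative_at_within
          mult.commute)
  qed simp
  then show ?thesis
    by (auto simp: slope_def has_integral_iff integral_mult_right)
qed

lemma slope_self [simp]: "slope p p = b' p"
  by (simp add: slope_def)

lemma slope_continuous: "continuous_on UNIV (\<lambda>z. slope (fst z) (snd z))"
proof -
  have "continuous_on UNIV
      (\<lambda>z. integral (cbox 0 1) (\<lambda>r. b' (snd z + r * (fst z - snd z))))"
    by (rule integral_continuous_on_param)
      (auto simp: split_beta intro!: continuous_intros)
  then show ?thesis by (simp add: slope_def)
qed

lemma slope_continuous_compose [continuous_intros]:
  "continuous_on A f \<Longrightarrow> continuous_on A g \<Longrightarrow> continuous_on A (\<lambda>z. slope (f z) (g z))"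
  using continuous_on_compose2[OF slope_continuous continuous_on_Pair[of A f g]] by simp

lemma slope_bound: "\<bar>slope p q\<bar> \<le> L"
proof -
  have "norm (integral {0..1} (\<lambda>r. b' (q + r * (p - q)))) \<le> L * (1 - 0)"
  proof (rule integral_bound)
    show "continuous_on {0..1} (\<lambda>r. b' (q + r * (p - q)))"
      by (rule b'_continuous_compose) (intro continuous_intros)
    show "norm (b' (q + r * (p - q))) \<le> L" for r
      using b'_bound by simp
  qed simp
  then show ?thesis by (simp add: slope_def)
qed

text \<open>The difference d = f - g solves the scalar linear equation d' = slope(f, g) d, which an
  integrating factor solves in closed form. Uniqueness, the two-sided Lipschitz bounds and
  differentiability of the flow in x are all read off from this identity.\<close>

lemma solution_diff:
  assumes f: "\<And>t. (f has_real_derivative b (f t)) (at t)"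
    and g: "\<And>t. (g has_real_derivative b (g t)) (at t)"
  shows "f t - g t = (f 0 - g 0) * exp (integral {0..1} (\<lambda>s. t * slope (f (s * t)) (g (s * t))))"
proof -
  have "continuous_on UNIV f" "continuous_on UNIV g"
    using DERIV_isCont[OF f] DERIV_isCont[OF g] by (auto intro: continuous_at_imp_continuous_on)
  then have "continuous_on UNIV (\<lambda>s. slope (f s) (g s))"
    by (rule slope_continuous_compose)
  \<comment> \<open>A global antiderivative of the coefficient, taken on the interval from minus to
    plus infinity, so that both signs of t are treated alike.\<close>
  then have "\<exists>H. \<forall>s. -\<infinity> < ereal s \<longrightarrow> ereal s < \<infinity> \<longrightarrow> (H has_vector_derivative slope (f s) (g s)) (at s)"
    by (intro einterval_antiderivative) (auto simp: continuous_on_eq_continuous_at)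
  then obtain H where H: "\<And>s. (H has_real_derivative slope (f s) (g s)) (at s)"
    by (auto simp: has_real_derivative_iff_has_vector_derivative)
  have "((\<lambda>s. (f s - g s) * exp (- H s)) has_real_derivative 0) (at s)" for s
  proof -
    have "((\<lambda>s. (f s - g s) * exp (- H s)) has_real_derivative
        (b (f s) - b (g s)) * exp (- H s) + exp (- H s) * (- slope (f s) (g s)) * (f s - g s)) (at s)"
      by (auto intro!: derivative_eq_intros f g H)
    then show ?thesis by (simp add: slope_eq)
  qed
  then have "(f t - g t) * exp (- H t) = (f 0 - g 0) * exp (- H 0)"
    using DERIV_isconst_all by blast
  then have 1: "f t - g t = (f 0 - g 0) * exp (H t - H 0)"
    by (simp add: exp_minus exp_diff field_simps)
  \<comment> \<open>Rescaling to [0, 1] produces the form that \<open>param_C_integral\<close>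
    handles.\<close>
  have "((\<lambda>s. t * slope (f (s * t)) (g (s * t))) has_integral H (1 * t) - H (0 * t)) {0..1}"
  proof (rule fundamental_theorem_of_calculus)
    fix s :: real
    have "((\<lambda>s. H (s * t)) has_real_derivative slope (f (s * t)) (g (s * t)) * t) (at s)"
      by (rule DERIV_chain2[OF H]) (auto intro!: derivative_eq_intros)
    then show "((\<lambda>s. H (s * t)) has_vector_derivative t * slope (f (s * t)) (g (s * t)))
        (at s within {0..1})"
      by (simp add: has_real_derivative_iff_has_vector_derivative has_vector_derivative_at_within
          mult.commute)
  qed simp
  then show ?thesis unfolding 1 by (simp add: has_integral_iff)
qed

lemma y_0 [simp]: "y x 0 = x"
  and y_deriv_t: "(y x has_real_derivative b (y x t)) (at t)"
  using char by (auto simp: characteristics_def)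

lemma y_continuous_t: "continuous_on A (y x)"
  using DERIV_isCont[OF y_deriv_t] by (auto intro: continuous_at_imp_continuous_on)

lemma y_continuous_t_compose [continuous_intros]:
  "continuous_on A f \<Longrightarrow> continuous_on A (\<lambda>s. y x (f s))"
  using continuous_on_compose2[OF y_continuous_t[of UNIV x]] by blast

lemma y_diff:
  "y z t - y x t = (z - x) * exp (integral {0..1} (\<lambda>s. t * slope (y z (s * t)) (y x (s * t))))"
  using solution_diff[of "y z" "y x" t] y_deriv_t by simp

lemma integral_slope_bound: "\<bar>integral {0..1} (\<lambda>s. t * slope (y z (s * t)) (y x (s * t)))\<bar> \<le> L * \<bar>t\<bar>"
proof -
  have "norm (integral {0..1} (\<lambda>s. t * slope (y z (s * t)) (y x (s * t)))) \<le> (L * \<bar>t\<bar>) * (1 - 0)"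
  proof (rule integral_bound)
    show "norm (t * slope (y z (s * t)) (y x (s * t))) \<le> L * \<bar>t\<bar>" for s
      using mult_left_mono[OF slope_bound[of "y z (s * t)" "y x (s * t)"], of "\<bar>t\<bar>"]
      by (simp add: abs_mult mult.commute)
  qed (auto intro!: continuous_intros)
  then show ?thesis by simp
qed

lemma y_diff_ge: "x \<le> z \<Longrightarrow> (z - x) * exp (- (L * \<bar>t\<bar>)) \<le> y z t - y x t"
  using integral_slope_bound[of t z x] unfolding y_diff by (intro mult_left_mono) auto

lemma y_diff_le: "x \<le> z \<Longrightarrow> y z t - y x t \<le> (z - x) * exp (L * \<bar>t\<bar>)"
  using integral_slope_bound[of t z x] unfolding y_diff by (intro mult_left_mono) auto

lemma y_abs_diff_le: "\<bar>y z t - y x t\<bar> \<le> \<bar>z - x\<bar> * exp (L * \<bar>t\<bar>)"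
  using y_diff_le[of x z t] y_diff_le[of z x t] y_diff_ge[of x z t] y_diff_ge[of z x t]
  by (smt (verit) exp_gt_zero mult_nonneg_nonneg)

text \<open>Lipschitz dependence on x, with a factor that stays bounded near a given time, is
  combined with continuity in t for one fixed starting point.\<close>

lemma y_continuous: "continuous_on UNIV (\<lambda>p. y (snd p) (fst p))"
  unfolding continuous_on_def
proof (intro ballI)
  fix q :: "real \<times> real"
  have "((\<lambda>p. \<bar>snd p - snd q\<bar> * exp (L * \<bar>fst p\<bar>)) \<longlongrightarrow> \<bar>snd q - snd q\<bar> * exp (L * \<bar>fst q\<bar>)) (at q)"
    by (intro tendsto_intros)
  then have "((\<lambda>p. \<bar>snd p - snd q\<bar> * exp (L * \<bar>fst p\<bar>)) \<longlongrightarrow> 0) (at q)" by simp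
  then have "((\<lambda>p. y (snd p) (fst p) - y (snd q) (fst p)) \<longlongrightarrow> 0) (at q)"
    by (rule Lim_null_comparison[rotated]) (simp add: y_abs_diff_le)
  moreover have "((\<lambda>p. y (snd q) (fst p)) \<longlongrightarrow> y (snd q) (fst q)) (at q)"
    using DERIV_isCont[OF y_deriv_t[of "snd q" "fst q"]]
    by (rule isCont_tendsto_compose) (intro tendsto_intros)
  ultimately show "((\<lambda>p. y (snd p) (fst p)) \<longlongrightarrow> y (snd q) (fst q)) (at q)"
    using tendsto_add by fastforce
qed

lemma y_continuous_compose [continuous_intros]:
  "continuous_on A f \<Longrightarrow> continuous_on A g \<Longrightarrow> continuous_on A (\<lambda>z. y (f z) (g z))"
  using continuous_on_compose2[OF y_continuous continuous_on_Pair[of A g f]] by simp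

text \<open>Caratheodory's form of differentiability: by \<open>y_diff\<close> the difference
  quotient in x is exactly exp (G z), where G is continuous, and at z = x the slope becomes
  b'.\<close>

lemma y_deriv_x:
  "((\<lambda>x. y x t) has_real_derivative exp (integral {0..1} (\<lambda>s. t * b' (y x (s * t))))) (at x)"
proof -
  define G where "G z = integral (cbox 0 1) (\<lambda>s. t * slope (y z (s * t)) (y x (s * t)))" for z
  have "continuous_on UNIV G"
    unfolding G_def
    by (rule integral_continuous_on_param) (auto simp: split_beta intro!: continuous_intros)
  then have "isCont (\<lambda>z. exp (G z)) x"
    by (auto simp: continuous_on_eq_continuous_at intro!: continuous_intros)
  moreover have "y z t - y x t = exp (G z) * (z - x)" for z
    unfolding G_def using y_diff[of z t x] by simp
  ultimately show ?thesis
    unfolding CARAT_DERIV by (intro exI[of _ "\<lambda>z. exp (G z)"]) (simp add: G_def)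
qed

text \<open>Bootstrapping: if y and b' have class m, so have b' along y, its time integral and the
  exponential of that. This is the x-derivative of y, which therefore has class m + 1.\<close>

lemma param_C_flow: "C_class m b' \<Longrightarrow> param_C (Suc m) (\<lambda>t x. y x t)"
proof -
  have step: "param_C (Suc m) (\<lambda>t x. y x t)" if "C_class m b'" "param_C m (\<lambda>t x. y x t)" for m
    by (rule param_C_SucI[OF y_continuous _ y_deriv_x])
      (rule param_C_compose[OF C_class_exp param_C_integral[OF param_C_compose[OF that]]])
  have "C_class m b' \<Longrightarrow> param_C m (\<lambda>t x. y x t)"
  proof (induction m)
    case (Suc m)
    show ?case by (rule step[OF C_class_SucD[OF Suc.prems] Suc.IH[OF C_class_SucD[OF Suc.prems]]])
  qed (simp add: y_continuous)
  then show "C_class m b' \<Longrightarrow> param_C (Suc m) (\<lambda>t x. y x t)"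
    using step by blast
qed

text \<open>The trajectory shifted by one solves the same equation from the same starting point, so
  \<open>solution_diff\<close> makes the difference vanish.\<close>

lemma y_plus_1:
  assumes "periodic1 b"
  shows "y (x + 1) t = y x t + 1"
proof -
  have "((\<lambda>t. y x t + 1) has_real_derivative b (y x t + 1)) (at t)" for t
    using assms y_deriv_t[of x t] by (auto simp: periodic1_def intro!: derivative_eq_intros)
  from solution_diff[OF y_deriv_t this, of "x + 1" t] show ?thesis by simp
qed

text \<open>Method of characteristics along the curve r -> (r, y x (r - t)), which passes through
  (t, x). Anchoring it there yields both the formula for v in terms of v0 (s = 0) and the relation
  between consecutive time levels.\<close>

lemma transport_solution_along:
  assumes v: "transport_solution b v0 T v" and s: "s \<in> {0..T}" and t: "t \<in> {0..T}"
  shows "v s (y x (s - t)) = v t x"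
proof -
  have "((\<lambda>r. v r (y x (r - t))) has_field_derivative 0) (at r within {0..T})" if r: "r \<in> {0..T}" for r
  proof -
    obtain vt vx where d: "((\<lambda>(s, z). v s z) has_derivative (\<lambda>(ds, dz). vt * ds + vx * dz))
          (at (r, y x (r - t)) within {0..T} \<times> UNIV)" and e: "vt + b (y x (r - t)) * vx = 0"
      using v r unfolding transport_solution_def by blast
    have "((\<lambda>r. y x (r - t)) has_real_derivative b (y x (r - t)) * 1) (at r within {0..T})"
      by (rule DERIV_chain2[OF y_deriv_t]) (auto intro!: derivative_eq_intros)
    then have 1: "((\<lambda>r. (r, y x (r - t))) has_derivative (\<lambda>h. (h, b (y x (r - t)) * h))) (at r within {0..T})"
      by (intro has_derivative_Pair) (auto simp: has_field_derivative_def)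
    have "((\<lambda>r. (\<lambda>(s, z). v s z) (r, y x (r - t))) has_derivative
        (\<lambda>h. (\<lambda>(ds, dz). vt * ds + vx * dz) (h, b (y x (r - t)) * h))) (at r within {0..T})"
      by (rule has_derivative_in_compose[OF 1 has_derivative_subset[OF d]]) auto
    moreover have "vt * h + vx * (b (y x (r - t)) * h) = (vt + b (y x (r - t)) * vx) * h" for h
      by (simp add: algebra_simps)
    ultimately show ?thesis
      using e by (simp add: has_field_derivative_def lambda_zero)
  qed
  then have "\<exists>c. \<forall>r\<in>{0..T}. v r (y x (r - t)) = c"
    by (intro has_field_derivative_zero_constant) auto
  then show ?thesis
    using s t by (metis diff_self y_0)
qed

end

section \<open>One-periodic functions on the line\<close>

lemma periodic1_of_int:
  assumes "periodic1 f"
  shows "f (x + of_int n) = f x"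
proof (induction n rule: int_induct[of _ 0])
  case (step1 i)
  then show ?case using assms by (metis ab_semigroup_add_class.add_ac(1) of_int_1 of_int_add periodic1_def)
next
  case (step2 i)
  have "f (x + of_int (i - 1) + 1) = f (x + of_int (i - 1))"
    using assms unfolding periodic1_def by blast
  moreover have "x + of_int (i - 1) + 1 = x + of_int i" by simp
  ultimately show ?case using step2 by metis
qed simp

lemma periodic1_bounded:
  assumes "periodic1 f" "continuous_on UNIV f"
  shows "\<exists>B. \<forall>x. \<bar>f x\<bar> \<le> B"
proof -
  have "bounded (f ` {0..1})"
    using assms(2) by (intro compact_imp_bounded compact_continuous_image)
      (auto intro: continuous_on_subset)
  then obtain B where B: "\<And>x. x \<in> {0..1} \<Longrightarrow> \<bar>f x\<bar> \<le> B"
    unfolding bounded_iff by (metis image_eqI real_norm_def)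
  have "f x = f (x - of_int \<lfloor>x\<rfloor>)" for x
    using periodic1_of_int[OF assms(1), of "x - of_int \<lfloor>x\<rfloor>" "\<lfloor>x\<rfloor>"] by simp
  moreover have "x - of_int \<lfloor>x\<rfloor> \<in> {0..1}" for x :: real
    by (simp add: le_less less_diff_eq) linarith
  ultimately show ?thesis using B by metis
qed

lemma periodic1_deriv:
  assumes "periodic1 f"
  shows "periodic1 (deriv f)"
proof -
  have "(f has_field_derivative D) (at (x + 1)) \<longleftrightarrow> (f has_field_derivative D) (at x)" for D x
    using assms DERIV_shift[of f D x 1] by (simp add: periodic1_def)
  then show ?thesis by (simp add: periodic1_def deriv_def)
qed

section \<open>Periodic and piecewise continuous integrands\<close>

text \<open>Cut [a, a + 1] at an integer and shift one piece by a period. An arbitrary a is required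
  because the flow carries the unit interval to [Y 0, Y 0 + 1].\<close>

lemma periodic1_has_integral:
  fixes f :: "real \<Rightarrow> real"
  assumes "periodic1 f" and f: "(f has_integral I) {0..1}"
  shows "f integrable_on {a..b}" and "(f has_integral I) {a..a + 1}"
proof -
  have shift: "(f has_integral J) {a + of_int n..b + of_int n} \<longleftrightarrow> (f has_integral J) {a..b}" for a b J n
  proof -
    have "f \<circ> (+) (of_int n) = f"
      using periodic1_of_int[OF assms(1)] by (auto simp: add.commute)
    then show ?thesis
      using has_integral_shift_Icc_real[of f "of_int n" J a b] by simp
  qed
  have unit: "(f has_integral I) {of_int n..of_int n + 1}" for n
    using shift[of I 0 n 1] f by (simp add: add.commute)
  have sym: "f integrable_on {- real n..real n}" for n
  proof (induction n)
    case (Suc n)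
    have l: "f integrable_on {- real n - 1..- real n}" and r: "f integrable_on {real n..real n + 1}"
      using has_integral_integrable[OF unit[of "- int n - 1"]] has_integral_integrable[OF unit[of "int n"]]
      by simp_all
    note combine = Henstock_Kurzweil_Integration.integrable_combine
    have "f integrable_on {- real n - 1..real n}"
      by (rule combine[OF _ _ l Suc.IH]) simp_all
    from combine[OF _ _ this r] have "f integrable_on {- real n - 1..real n + 1}"
      by simp
    moreover have "- real (Suc n) = - real n - 1" "real (Suc n) = real n + 1" by simp_all
    ultimately show ?case by (simp only:)
  qed (use integrable_on_refl[of f 0] in simp)
  show integrable: "f integrable_on {a..b}" for a b
  proof -
    define n where "n = nat \<lceil>max \<bar>a\<bar> \<bar>b\<bar>\<rceil>"
    have "max \<bar>a\<bar> \<bar>b\<bar> \<le> real n"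
      unfolding n_def by linarith
    then show ?thesis
      by (intro integrable_on_subinterval[OF sym[of n]]) auto
  qed
  define n where "n = \<lfloor>a\<rfloor>"
  have n: "of_int n \<le> a" "a \<le> of_int n + 1"
    unfolding n_def by linarith+
  have "integral {of_int n..a} f + integral {a..of_int n + 1} f = I"
    using Henstock_Kurzweil_Integration.integral_combine[OF n integrable] unit[of n] by (auto simp: integral_unique)
  moreover have "(f has_integral integral {of_int n..a} f) {of_int n + 1..a + 1}"
    using integrable_integral[OF integrable[of "of_int n" a]] shift[of _ "of_int n" 1 a] by simp
  ultimately show "(f has_integral I) {a..a + 1}"
    using has_integral_combine[of a "of_int n + 1" "a + 1" f "integral {a..of_int n + 1} f"
        "integral {of_int n..a} f"] n integrable_integral[OF integrable[of a "of_int n + 1"]]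
    by (simp add: add.commute)
qed

lemma unit_interval_cell:
  assumes "M \<ge> 1" and "x \<in> {0..<1}"
  obtains i where "i < M" and "x \<in> {real i / real M..<real (Suc i) / real M}"
proof -
  define i where "i = nat \<lfloor>x * real M\<rfloor>"
  have "0 \<le> x * real M" "x * real M < real M"
    using assms by auto
  then have "i < M" "real i \<le> x * real M" "x * real M < real (Suc i)"
    unfolding i_def by linarith+
  then show ?thesis
    using assms that[of i] by (auto simp: field_simps)
qed

context
  fixes M :: nat and f :: "real \<Rightarrow> real" and h :: "nat \<Rightarrow> real \<Rightarrow> real"
  assumes M: "M \<ge> 1"
    and h: "\<And>i. i < M \<Longrightarrow> continuous_on UNIV (h i)"
    and f: "\<And>i x. i < M \<Longrightarrow> x \<in> {real i / real M..<real (Suc i) / real M} \<Longrightarrow> f x = h i x"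
begin

text \<open>The function f is known on the half-open cell; the right end is a single point, so the
  continuous \<open>h i\<close> may be integrated over the closed cell instead.\<close>

lemma piecewise_has_integral_cell:
  assumes "i < M"
  shows "(f has_integral integral {real i / real M..real (Suc i) / real M} (h i))
    {real i / real M..real (Suc i) / real M}"
proof (rule has_integral_spike_finite[of "{real (Suc i) / real M}" _ f "h i"])
  have "h i integrable_on {real i / real M..real (Suc i) / real M}"
    using h[OF assms] by (intro integrable_continuous_real) (auto intro: continuous_on_subset)
  then show "(h i has_integral integral {real i / real M..real (Suc i) / real M} (h i))
      {real i / real M..real (Suc i) / real M}"
    by (rule integrable_integral)
  show "f x = h i x" if "x \<in> {real i / real M..real (Suc i) / real M} - {real (Suc i) / real M}" for x
    using that assms by (intro f) auto
qed simp

lemma piecewise_has_integral: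
  "(f has_integral (\<Sum>i<M. integral {real i / real M..real (Suc i) / real M} (h i))) {0..1}"
proof -
  have "m \<le> M \<Longrightarrow> (f has_integral
      (\<Sum>i<m. integral {real i / real M..real (Suc i) / real M} (h i))) {0..real m / real M}" for m
  proof (induction m)
    case (Suc m)
    then show ?case
      using has_integral_combine[OF _ _ Suc.IH piecewise_has_integral_cell[of m]] M
      by (auto simp: divide_right_mono)
  qed (use has_integral_refl(2)[of f 0] in simp)
  from this[of M] show ?thesis using M by simp
qed

lemma piecewise_set_integrable: "set_integrable lborel {0<..<1} f"
proof -
  let ?A = "\<lambda>i. {real i / real M..<real (Suc i) / real M}"
  have "set_integrable lborel (?A i) f" if "i < M" for i
  proof -
    have "set_integrable lborel (?A i) (h i)"
      by (rule set_integrable_subset[OF borel_integrable_atLeastAtMost'[of "real i / real M" "real (Suc i) / real M"]])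
        (use h[OF that] in \<open>auto intro: continuous_on_subset\<close>)
    then show ?thesis
      by (rule set_integrable_cong[THEN iffD1, rotated -1]) (use f[OF that] in auto)
  qed
  then have "set_integrable lborel (\<Union>i\<in>{..<M}. ?A i) f"
    by (intro set_integrable_UN) auto
  moreover have "x \<in> (\<Union>i\<in>{..<M}. ?A i)" if x: "x \<in> {0<..<1}" for x
  proof -
    have "x \<in> {0..<1}" using x by simp
    then show ?thesis by (rule unit_interval_cell[OF M]) blast
  qed
  ultimately show ?thesis
    by (intro set_integrable_subset[of lborel _ f "{0<..<1}"]) auto
qed

text \<open>The bridge between the Lebesgue integral that defines \<open>L2_inner\<close> and the
  gauge integral used for all computations on subintervals.\<close>

lemma piecewise_LINT:
  "(LINT x:{0<..<1}|lborel. f x) = (\<Sum>i<M. integral {real i / real M..real (Suc i) / real M} (h i))"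
  using set_borel_integral_eq_integral(2)[OF piecewise_set_integrable]
    integral_unique[OF piecewise_has_integral]
  by (simp add: integral_open_interval_real)

end

section \<open>Gauss--Legendre quadrature and Lagrange polynomials\<close>

lemma gauss_legendre_weight: "gauss_legendre k \<xi> w \<Longrightarrow> \<alpha> \<le> k \<Longrightarrow> 0 < w \<alpha>"
  and gauss_legendre_node: "gauss_legendre k \<xi> w \<Longrightarrow> \<alpha> \<le> k \<Longrightarrow> -1 < \<xi> \<alpha> \<and> \<xi> \<alpha> < 1"
  and gauss_legendre_inj: "gauss_legendre k \<xi> w \<Longrightarrow> inj_on \<xi> {..k}"
  by (auto simp: gauss_legendre_def)

text \<open>The affine pull-back to (-1, 1) preserves the degree. Exactness of the rule enters every
  later argument in this form.\<close>

lemma gauss_legendre_interval: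
  assumes gl: "gauss_legendre k \<xi> w" and "a < c" and p: "degree p \<le> 2 * k + 1"
  shows "(\<Sum>\<alpha>\<le>k. w \<alpha> / 2 * (c - a) * poly p ((a + c) / 2 + \<xi> \<alpha> * ((c - a) / 2)))
    = integral {a..c} (poly p)"
proof -
  define m where "m = (c - a) / 2"
  have m: "m > 0" using \<open>a < c\<close> by (simp add: m_def)
  define q where "q = p \<circ>\<^sub>p [:(a + c) / 2, m:]"
  have q: "poly q s = poly p (m * s + (a + c) / 2)" for s
    by (simp add: q_def poly_pcompose algebra_simps)
  have "degree q \<le> 2 * k + 1"
    using p m by (simp add: q_def degree_pcompose)
  then have 1: "(\<Sum>\<alpha>\<le>k. w \<alpha> * poly q (\<xi> \<alpha>)) = (LINT x:{-1<..<1}|lborel. poly q x)"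
    using gl unfolding gauss_legendre_def by blast
  have "set_integrable lborel {-1..1} (poly q)"
    by (intro borel_integrable_atLeastAtMost' continuous_intros)
  then have "set_integrable lborel {-1<..<1} (poly q)"
    by (rule set_integrable_subset) auto
  then have 2: "(LINT x:{-1<..<1}|lborel. poly q x) = integral {-1..1} (poly q)"
    by (simp add: set_borel_integral_eq_integral(2) integral_open_interval_real)
  have "(poly p has_integral integral {a..c} (poly p)) (cbox a c)"
    by (auto intro!: integrable_integral integrable_continuous_real continuous_intros)
  from has_integral_affinity'[OF this m, of "(a + c) / 2"]
  have "((\<lambda>s. poly p (m * s + (a + c) / 2)) has_integral integral {a..c} (poly p) / m)
      {(a - (a + c) / 2) / m..(c - (a + c) / 2) / m}"
    by (simp only: real_scaleR_def DIM_real power_one_right cbox_interval divide_inverse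
        mult.commute[of "inverse m"])
  moreover have "(a - (a + c) / 2) / m = -1" "(c - (a + c) / 2) / m = 1"
    using m \<open>a < c\<close> by (auto simp: m_def field_simps)
  moreover have "poly q = (\<lambda>s. poly p (m * s + (a + c) / 2))"
    using q by blast
  ultimately have "integral {-1..1} (poly q) = integral {a..c} (poly p) / m"
    by (simp add: integral_unique)
  then have "integral {a..c} (poly p) = m * (\<Sum>\<alpha>\<le>k. w \<alpha> * poly q (\<xi> \<alpha>))"
    using 1 2 m by simp
  also have "\<dots> = (\<Sum>\<alpha>\<le>k. w \<alpha> / 2 * (c - a) * poly p ((a + c) / 2 + \<xi> \<alpha> * ((c - a) / 2)))"
    unfolding sum_distrib_left q by (intro sum.cong) (auto simp: m_def algebra_simps)
  finally show ?thesis by simp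
qed

definition lagrange :: "nat \<Rightarrow> (nat \<Rightarrow> real) \<Rightarrow> nat \<Rightarrow> real poly" where
  "lagrange k z \<alpha> = (\<Prod>\<beta>\<in>{..k} - {\<alpha>}. smult (1 / (z \<alpha> - z \<beta>)) [:- z \<beta>, 1:])"

lemma degree_lagrange:
  assumes "\<alpha> \<le> k"
  shows "degree (lagrange k z \<alpha>) \<le> k"
proof -
  have "degree (lagrange k z \<alpha>) \<le> (\<Sum>\<beta>\<in>{..k} - {\<alpha>}. degree (smult (1 / (z \<alpha> - z \<beta>)) [:- z \<beta>, 1:]))"
    unfolding lagrange_def by (rule order_trans[OF degree_prod_sum_le]) (simp_all only: finite_Diff finite_atMost o_def order_refl)
  also have "\<dots> \<le> (\<Sum>\<beta>\<in>{..k} - {\<alpha>}. 1)"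
    by (intro sum_mono) (auto simp: degree_smult_eq)
  also have "\<dots> = k" using assms by simp
  finally show ?thesis .
qed

lemma poly_lagrange:
  assumes "inj_on z {..k}" "\<alpha> \<le> k" "\<beta> \<le> k"
  shows "poly (lagrange k z \<alpha>) (z \<beta>) = (if \<alpha> = \<beta> then 1 else 0)"
proof (cases "\<alpha> = \<beta>")
  case True
  have "z \<alpha> - z \<gamma> \<noteq> 0" if "\<gamma> \<in> {..k} - {\<alpha>}" for \<gamma>
    using assms that by (auto simp: inj_on_def)
  then show ?thesis
    using True by (auto simp: lagrange_def poly_prod divide_simps intro!: prod.neutral)
next
  case False
  then show ?thesis
    using assms by (auto simp: lagrange_def poly_prod intro!: prod_zero bexI[of _ \<beta>])
qed

lemma lagrange_interpolation:
  assumes inj: "inj_on z {..k}" and p: "degree p \<le> k"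
  shows "p = (\<Sum>\<alpha>\<le>k. smult (poly p (z \<alpha>)) (lagrange k z \<alpha>))"
proof (rule poly_eqI_degree[of "z ` {..k}"])
  fix x assume "x \<in> z ` {..k}"
  then obtain \<beta> where \<beta>: "\<beta> \<le> k" "x = z \<beta>" by auto
  have "poly (\<Sum>\<alpha>\<le>k. smult (poly p (z \<alpha>)) (lagrange k z \<alpha>)) (z \<beta>)
      = (\<Sum>\<alpha>\<le>k. if \<alpha> = \<beta> then poly p (z \<beta>) else 0)"
    unfolding poly_sum using inj \<beta> by (intro sum.cong) (auto simp: poly_lagrange)
  then show "poly p x = poly (\<Sum>\<alpha>\<le>k. smult (poly p (z \<alpha>)) (lagrange k z \<alpha>)) x"
    using \<beta> by simp
next
  have *: "card (z ` {..k}) = Suc k"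
    using card_image[OF inj] by simp
  then show "degree p < card (z ` {..k})" using p by simp
  have "degree (\<Sum>\<alpha>\<le>k. smult (poly p (z \<alpha>)) (lagrange k z \<alpha>)) \<le> k"
    by (intro degree_sum_le) (auto intro: order_trans[OF degree_smult_le] degree_lagrange)
  then show "degree (\<Sum>\<alpha>\<le>k. smult (poly p (z \<alpha>)) (lagrange k z \<alpha>)) < card (z ` {..k})"
    using * by simp
qed

lemma poly_lipschitz_on_interval:
  "\<exists>D\<ge>0. \<forall>s\<in>{a..c}. \<forall>s'\<in>{a..c}. \<bar>poly p s - poly p s'\<bar> \<le> D * \<bar>s - s'\<bar>" for p :: "real poly"
proof -
  have "bounded (poly (pderiv p) ` {a..c})"
    by (intro compact_imp_bounded compact_continuous_image continuous_intros) auto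
  then obtain D where D: "\<And>s. s \<in> {a..c} \<Longrightarrow> norm (poly (pderiv p) s) \<le> D"
    unfolding bounded_iff by (metis image_eqI)
  have "\<bar>poly p s - poly p s'\<bar> \<le> max D 0 * \<bar>s - s'\<bar>" if "s \<in> {a..c}" "s' \<in> {a..c}" for s s'
  proof -
    have "norm (poly p s - poly p s') \<le> max D 0 * norm (s - s')"
    proof (rule field_differentiable_bound[of "{a..c}"])
      show "(poly p has_field_derivative poly (pderiv p) z) (at z within {a..c})" for z
        using poly_DERIV has_field_derivative_at_within by blast
      show "norm (poly (pderiv p) z) \<le> max D 0" if "z \<in> {a..c}" for z
        using D[OF that] by simp
    qed (use that in auto)
    then show ?thesis by simp
  qed
  then show ?thesis by (intro exI[of _ "max D 0"]) auto
qed

text \<open>All norms on polynomials of bounded degree are equivalent; expanding in the Lagrange basis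
  at the Gauss nodes makes this quantitative.\<close>

lemma gauss_square_lipschitz:
  assumes gl: "gauss_legendre k \<xi> w"
  shows "\<exists>K\<ge>0. \<forall>p s s'. degree p \<le> k \<longrightarrow> s \<in> {-1..1} \<longrightarrow> s' \<in> {-1..1} \<longrightarrow>
    \<bar>(poly p s)\<^sup>2 - (poly p s')\<^sup>2\<bar> \<le> K * \<bar>s - s'\<bar> * (\<Sum>\<alpha>\<le>k. w \<alpha> * (poly p (\<xi> \<alpha>))\<^sup>2)"
proof -
  note inj = gauss_legendre_inj[OF gl]
  let ?l = "lagrange k \<xi>"
  \<comment> \<open>A Lipschitz constant of p on [-1, 1]. It is applied to the products of two
    Lagrange polynomials, a finite family determined by the nodes.\<close>
  define D' where "D' p = (SOME D. D \<ge> 0 \<and> (\<forall>s\<in>{-1..1}. \<forall>s'\<in>{-1..1}.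
      \<bar>poly p s - poly p s'\<bar> \<le> D * \<bar>s - s'\<bar>))" for p :: "real poly"
  have D': "D' p \<ge> 0 \<and> (\<forall>s\<in>{-1..1}. \<forall>s'\<in>{-1..1}. \<bar>poly p s - poly p s'\<bar> \<le> D' p * \<bar>s - s'\<bar>)" for p
    unfolding D'_def by (rule someI_ex) (rule poly_lipschitz_on_interval)
  define D where "D \<alpha> \<beta> = D' (?l \<alpha> * ?l \<beta>)" for \<alpha> \<beta>
  have D0: "D \<alpha> \<beta> \<ge> 0" for \<alpha> \<beta>
    unfolding D_def using D' by simp
  have D: "\<bar>poly (?l \<alpha> * ?l \<beta>) s - poly (?l \<alpha> * ?l \<beta>) s'\<bar> \<le> D \<alpha> \<beta> * \<bar>s - s'\<bar>"
    if "s \<in> {-1..1}" "s' \<in> {-1..1}" for \<alpha> \<beta> s s'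
    unfolding D_def using D'[rule_format, of "?l \<alpha> * ?l \<beta>"] that by blast
  \<comment> \<open>With S the weighted sum of squares, each squared nodal value is at most S / w
    \<alpha>, so a product of two nodal values is at most (1 / w \<alpha> + 1 / w \<beta>) S. This
    is multiplied by the Lipschitz constant of the basis product and summed.\<close>
  define K where "K = (\<Sum>\<alpha>\<le>k. \<Sum>\<beta>\<le>k. D \<alpha> \<beta> * (1 / w \<alpha> + 1 / w \<beta>))"
  have w: "w \<alpha> > 0" if "\<alpha> \<le> k" for \<alpha>
    using gauss_legendre_weight[OF gl that] .
  have "\<bar>(poly p s)\<^sup>2 - (poly p s')\<^sup>2\<bar> \<le> K * \<bar>s - s'\<bar> * (\<Sum>\<alpha>\<le>k. w \<alpha> * (poly p (\<xi> \<alpha>))\<^sup>2)"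
    if p: "degree p \<le> k" and s: "s \<in> {-1..1}" "s' \<in> {-1..1}" for p s s'
  proof -
    define S where "S = (\<Sum>\<alpha>\<le>k. w \<alpha> * (poly p (\<xi> \<alpha>))\<^sup>2)"
    have pS: "(poly p (\<xi> \<alpha>))\<^sup>2 \<le> S / w \<alpha>" if "\<alpha> \<le> k" for \<alpha>
    proof -
      have "w \<alpha> * (poly p (\<xi> \<alpha>))\<^sup>2 \<le> S"
        unfolding S_def by (rule member_le_sum) (use that w in \<open>auto simp: less_imp_le\<close>)
      then show ?thesis using w[OF that] by (simp add: field_simps)
    qed
    have "S \<ge> 0" unfolding S_def by (intro sum_nonneg) (use w in \<open>auto simp: less_imp_le\<close>)
    have sq: "(poly p s)\<^sup>2 = (\<Sum>\<alpha>\<le>k. \<Sum>\<beta>\<le>k. poly p (\<xi> \<alpha>) * poly p (\<xi> \<beta>) * poly (?l \<alpha> * ?l \<beta>) s)" for s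
    proof -
      have "poly p s = (\<Sum>\<alpha>\<le>k. poly p (\<xi> \<alpha>) * poly (?l \<alpha>) s)"
        by (subst lagrange_interpolation[OF inj p]) (simp add: poly_sum)
      then show ?thesis
        by (simp add: power2_eq_square sum_product mult_ac)
    qed
    have "\<bar>(poly p s)\<^sup>2 - (poly p s')\<^sup>2\<bar> = \<bar>\<Sum>\<alpha>\<le>k. \<Sum>\<beta>\<le>k. poly p (\<xi> \<alpha>) * poly p (\<xi> \<beta>) *
        (poly (?l \<alpha> * ?l \<beta>) s - poly (?l \<alpha> * ?l \<beta>) s')\<bar>"
      unfolding sq by (simp only: sum_subtractf right_diff_distrib)
    also have "\<dots> \<le> (\<Sum>\<alpha>\<le>k. \<Sum>\<beta>\<le>k. \<bar>poly p (\<xi> \<alpha>) * poly p (\<xi> \<beta>) *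
        (poly (?l \<alpha> * ?l \<beta>) s - poly (?l \<alpha> * ?l \<beta>) s')\<bar>)"
      by (intro order_trans[OF sum_abs] sum_mono order_refl)
    also have "\<dots> \<le> (\<Sum>\<alpha>\<le>k. \<Sum>\<beta>\<le>k. D \<alpha> \<beta> * (1 / w \<alpha> + 1 / w \<beta>) * (\<bar>s - s'\<bar> * S))"
    proof (intro sum_mono)
      fix \<alpha> \<beta> assume ab: "\<alpha> \<in> {..k}" "\<beta> \<in> {..k}"
      have "2 * \<bar>poly p (\<xi> \<alpha>) * poly p (\<xi> \<beta>)\<bar> \<le> (poly p (\<xi> \<alpha>))\<^sup>2 + (poly p (\<xi> \<beta>))\<^sup>2"
        using sum_squares_bound[of "\<bar>poly p (\<xi> \<alpha>)\<bar>" "\<bar>poly p (\<xi> \<beta>)\<bar>"] by (simp add: abs_mult)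
      then have "\<bar>poly p (\<xi> \<alpha>) * poly p (\<xi> \<beta>)\<bar> \<le> (poly p (\<xi> \<alpha>))\<^sup>2 + (poly p (\<xi> \<beta>))\<^sup>2"
        using abs_ge_zero[of "poly p (\<xi> \<alpha>) * poly p (\<xi> \<beta>)"] by linarith
      also have "\<dots> \<le> (1 / w \<alpha> + 1 / w \<beta>) * S"
        using pS[of \<alpha>] pS[of \<beta>] ab by (simp add: algebra_simps)
      finally have 1: "\<bar>poly p (\<xi> \<alpha>) * poly p (\<xi> \<beta>)\<bar> \<le> (1 / w \<alpha> + 1 / w \<beta>) * S" .
      have "\<bar>poly p (\<xi> \<alpha>) * poly p (\<xi> \<beta>)\<bar> * \<bar>poly (?l \<alpha> * ?l \<beta>) s - poly (?l \<alpha> * ?l \<beta>) s'\<bar>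
          \<le> ((1 / w \<alpha> + 1 / w \<beta>) * S) * (D \<alpha> \<beta> * \<bar>s - s'\<bar>)"
        using 1 D[OF s, of \<alpha> \<beta>] ab w \<open>S \<ge> 0\<close> by (intro mult_mono) (auto simp: less_imp_le)
      then show "\<bar>poly p (\<xi> \<alpha>) * poly p (\<xi> \<beta>) * (poly (?l \<alpha> * ?l \<beta>) s - poly (?l \<alpha> * ?l \<beta>) s')\<bar>
          \<le> D \<alpha> \<beta> * (1 / w \<alpha> + 1 / w \<beta>) * (\<bar>s - s'\<bar> * S)"
        unfolding abs_mult[of "poly p (\<xi> \<alpha>) * poly p (\<xi> \<beta>)"] by (simp only: mult_ac)
    qed
    also have "\<dots> = K * \<bar>s - s'\<bar> * S"
      unfolding K_def by (simp only: sum_distrib_right mult.assoc)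
    finally show ?thesis unfolding S_def .
  qed
  moreover have "K \<ge> 0"
    unfolding K_def using D0 w by (intro sum_nonneg mult_nonneg_nonneg) (auto simp: less_imp_le)
  ultimately show ?thesis by blast
qed

section \<open>The discontinuous Galerkin space\<close>

locale dg_mesh =
  fixes k :: nat and \<xi> w :: "nat \<Rightarrow> real" and M :: nat
  assumes gl: "gauss_legendre k \<xi> w" and M: "M \<ge> 1"
begin

abbreviation V :: "(real \<Rightarrow> real) set" where "V \<equiv> DG_space k M"

abbreviation cell :: "nat \<Rightarrow> real set" where
  "cell i \<equiv> {real i / real M..<real (Suc i) / real M}"

lemma M_pos [simp]: "0 < real M" "0 < M" "M \<noteq> 0"
  using M by auto

lemma cell_less: "real i / real M < real (Suc i) / real M"
  using M by (simp add: divide_strict_right_mono)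

lemma DG_cell_poly:
  assumes "u \<in> V" "i < M"
  obtains p where "degree p \<le> k" "\<And>x. x \<in> cell i \<Longrightarrow> u x = poly p x"
  using assms unfolding DG_space_def by blast

lemma DG_polys:
  assumes "u \<in> V"
  obtains p where "\<And>i. i < M \<Longrightarrow> degree (p i) \<le> k" "\<And>i x. i < M \<Longrightarrow> x \<in> cell i \<Longrightarrow> u x = poly (p i) x"
proof -
  have "\<exists>p. \<forall>i. i < M \<longrightarrow> degree (p i) \<le> k \<and> (\<forall>x\<in>cell i. u x = poly (p i) x)"
    using assms unfolding DG_space_def by (intro choice) blast
  then show thesis using that by blast
qed

lemma DG_periodic: "u \<in> V \<Longrightarrow> periodic1 u"
  by (simp add: DG_space_def)

lemma DG_add:
  assumes "u \<in> V" "v \<in> V"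
  shows "(\<lambda>x. u x + v x) \<in> V"
  unfolding DG_space_def
proof (intro CollectI conjI allI impI)
  show "periodic1 (\<lambda>x. u x + v x)"
    using assms[THEN DG_periodic] by (simp add: periodic1_def)
  fix i assume i: "i < M"
  obtain p where p: "degree p \<le> k" "\<And>x. x \<in> cell i \<Longrightarrow> u x = poly p x"
    using DG_cell_poly[OF assms(1) i] by metis
  obtain q where q: "degree q \<le> k" "\<And>x. x \<in> cell i \<Longrightarrow> v x = poly q x"
    using DG_cell_poly[OF assms(2) i] by metis
  show "\<exists>p. degree p \<le> k \<and> (\<forall>x\<in>cell i. u x + v x = poly p x)"
    using p q by (intro exI[of _ "p + q"]) (simp add: degree_add_le)
qed

lemma DG_scale:
  assumes "u \<in> V"
  shows "(\<lambda>x. c * u x) \<in> V"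
  unfolding DG_space_def
proof (intro CollectI conjI allI impI)
  show "periodic1 (\<lambda>x. c * u x)"
    using DG_periodic[OF assms] by (simp add: periodic1_def)
  fix i assume i: "i < M"
  obtain p where p: "degree p \<le> k" "\<And>x. x \<in> cell i \<Longrightarrow> u x = poly p x"
    using DG_cell_poly[OF assms(1) i] by metis
  show "\<exists>p. degree p \<le> k \<and> (\<forall>x\<in>cell i. c * u x = poly p x)"
    using p by (intro exI[of _ "smult c p"]) (simp add: order_trans[OF degree_smult_le])
qed

lemma DG_diff: "u \<in> V \<Longrightarrow> v \<in> V \<Longrightarrow> (\<lambda>x. u x - v x) \<in> V"
  using DG_add[OF _ DG_scale[of v "-1"]] by simp

lemma DG_const: "(\<lambda>x. c) \<in> V"
  unfolding DG_space_def by (auto simp: periodic1_def intro!: exI[of _ "[:c:]"])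

lemma DG_eqI:
  assumes "u \<in> V" "v \<in> V" and eq: "\<And>i x. i < M \<Longrightarrow> x \<in> cell i \<Longrightarrow> u x = v x"
  shows "u = v"
proof
  fix x :: real
  have "frac x \<in> {0..<1}" by (simp add: frac_lt_1)
  then obtain i where "i < M" "frac x \<in> cell i"
    using unit_interval_cell[OF M] by blast
  then have "u (frac x) = v (frac x)" by (rule eq)
  have "f (frac x) = f x" if "f \<in> V" for f
    using periodic1_of_int[OF DG_periodic[OF that], of "frac x" "\<lfloor>x\<rfloor>"] by (simp add: frac_def)
  from this[OF assms(1)] this[OF assms(2)] \<open>u (frac x) = v (frac x)\<close> show "u x = v x" by simp
qed

text \<open>The floor puts a node into the cell on its right, which matches the right-continuous
  representatives of \<open>DG_space\<close>.\<close>

definition DG_of :: "(nat \<Rightarrow> real poly) \<Rightarrow> real \<Rightarrow> real" where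
  "DG_of g x = poly (g (nat \<lfloor>frac x * real M\<rfloor>)) (frac x)"

lemma DG_of_cell:
  assumes "i < M" "x \<in> cell i"
  shows "DG_of g x = poly (g i) x"
proof -
  have 1: "real i \<le> x * real M" "x * real M < real i + 1"
    using assms(2) by (auto simp: field_simps)
  have "0 \<le> x" using assms(2) by (auto intro: order_trans[rotated])
  moreover have "x < 1"
  proof (rule ccontr)
    assume "\<not> x < 1"
    then have "1 * real M \<le> x * real M" by (intro mult_right_mono) auto
    moreover have "real i + 1 \<le> real M" using assms(1) by linarith
    ultimately show False using 1 by linarith
  qed
  ultimately have "frac x = x"
    by (simp add: frac_eq)
  moreover have "\<lfloor>x * real M\<rfloor> = int i"
    using 1 by (intro floor_unique) auto
  ultimately show ?thesis by (simp add: DG_of_def)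
qed

lemma DG_of_mem:
  assumes "\<And>i. i < M \<Longrightarrow> degree (g i) \<le> k"
  shows "DG_of g \<in> V"
  unfolding DG_space_def
  using assms DG_of_cell[of _ _ g] by (auto simp: periodic1_def DG_of_def frac_1_eq)

lemma DG_sum:
  assumes "finite Z" "\<And>z. z \<in> Z \<Longrightarrow> e z \<in> V"
  shows "(\<lambda>x. \<Sum>z\<in>Z. c z * e z x) \<in> V"
  using assms by (induction Z) (simp_all add: DG_const[of 0] DG_add DG_scale)

lemma L2_inner_piecewise:
  assumes "\<And>i. i < M \<Longrightarrow> continuous_on UNIV (h i)"
    "\<And>i x. i < M \<Longrightarrow> x \<in> cell i \<Longrightarrow> u x * v x = h i x"
  shows "L2_inner u v = (\<Sum>i<M. integral {real i / real M..real (Suc i) / real M} (h i))"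
  unfolding L2_inner_def by (rule piecewise_LINT[OF M assms])

lemma L2_inner_DG:
  assumes "\<And>i. i < M \<Longrightarrow> degree (p i) \<le> k" "\<And>i x. i < M \<Longrightarrow> x \<in> cell i \<Longrightarrow> u x = poly (p i) x"
    "\<And>i. i < M \<Longrightarrow> degree (q i) \<le> k" "\<And>i x. i < M \<Longrightarrow> x \<in> cell i \<Longrightarrow> v x = poly (q i) x"
  shows "L2_inner u v = (\<Sum>i<M. integral {real i / real M..real (Suc i) / real M} (poly (p i * q i)))"
  by (rule L2_inner_piecewise) (auto simp: assms intro!: continuous_intros)

definition cell_node :: "nat \<Rightarrow> nat \<Rightarrow> real" where
  "cell_node i \<alpha> = (real i / real M + real (Suc i) / real M) / 2
     + \<xi> \<alpha> * ((real (Suc i) / real M - real i / real M) / 2)"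

lemma affine_node_between:
  assumes "\<alpha> \<le> k" "a < c"
  shows "a < (a + c) / 2 + \<xi> \<alpha> * ((c - a) / 2)" "(a + c) / 2 + \<xi> \<alpha> * ((c - a) / 2) < c"
proof -
  have "-1 * ((c - a) / 2) < \<xi> \<alpha> * ((c - a) / 2)" "\<xi> \<alpha> * ((c - a) / 2) < 1 * ((c - a) / 2)"
    using gauss_legendre_node[OF gl assms(1)] assms(2) by (intro mult_strict_right_mono; simp)+
  then show "a < (a + c) / 2 + \<xi> \<alpha> * ((c - a) / 2)" "(a + c) / 2 + \<xi> \<alpha> * ((c - a) / 2) < c"
    by (simp_all add: field_simps)
qed

lemma cell_node_mem: "\<alpha> \<le> k \<Longrightarrow> cell_node i \<alpha> \<in> cell i"
  using affine_node_between[OF _ cell_less, of \<alpha> i] by (simp add: cell_node_def less_imp_le)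

lemma cell_node_inj: "inj_on (cell_node i) {..k}"
  using gauss_legendre_inj[OF gl] cell_less[of i] by (auto simp: inj_on_def cell_node_def)

text \<open>The rule is exact for products of two polynomials of degree k, so V is a Euclidean space
  in the values at the Gauss nodes of the cells, with weights w \<alpha> / (2 M). Hence the Lagrange
  basis at these nodes is orthogonal.\<close>

lemma L2_inner_nodes:
  assumes "u \<in> V" "v \<in> V"
  shows "L2_inner u v =
    (\<Sum>i<M. \<Sum>\<alpha>\<le>k. w \<alpha> / (2 * real M) * (u (cell_node i \<alpha>) * v (cell_node i \<alpha>)))"
proof -
  obtain p where p: "\<And>i. i < M \<Longrightarrow> degree (p i) \<le> k" "\<And>i x. i < M \<Longrightarrow> x \<in> cell i \<Longrightarrow> u x = poly (p i) x"
    using DG_polys[OF assms(1)] by metis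
  obtain q where q: "\<And>i. i < M \<Longrightarrow> degree (q i) \<le> k" "\<And>i x. i < M \<Longrightarrow> x \<in> cell i \<Longrightarrow> v x = poly (q i) x"
    using DG_polys[OF assms(2)] by metis
  have "L2_inner u v = (\<Sum>i<M. integral {real i / real M..real (Suc i) / real M} (poly (p i * q i)))"
    by (rule L2_inner_DG[OF p q])
  also have "\<dots> = (\<Sum>i<M. \<Sum>\<alpha>\<le>k. w \<alpha> / (2 * real M) * (u (cell_node i \<alpha>) * v (cell_node i \<alpha>)))"
  proof (intro sum.cong refl)
    fix i assume "i \<in> {..<M}"
    then have i: "i < M" by simp
    have "degree (p i * q i) \<le> 2 * k + 1"
      using degree_mult_le[of "p i" "q i"] p(1)[OF i] q(1)[OF i] by linarith
    from gauss_legendre_interval[OF gl cell_less[of i] this, symmetric]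
    show "integral {real i / real M..real (Suc i) / real M} (poly (p i * q i)) =
        (\<Sum>\<alpha>\<le>k. w \<alpha> / (2 * real M) * (u (cell_node i \<alpha>) * v (cell_node i \<alpha>)))"
      unfolding cell_node_def[symmetric]
    proof (rule trans, intro sum.cong refl)
      fix \<alpha> assume "\<alpha> \<in> {..k}"
      then have "cell_node i \<alpha> \<in> cell i" by (intro cell_node_mem) simp
      then show "w \<alpha> / 2 * (real (Suc i) / real M - real i / real M) * poly (p i * q i) (cell_node i \<alpha>)
          = w \<alpha> / (2 * real M) * (u (cell_node i \<alpha>) * v (cell_node i \<alpha>))"
        using p(2)[OF i] q(2)[OF i] by (simp add: diff_divide_distrib[symmetric])
    qed
  qed
  finally show ?thesis .
qed

lemma L2_norm_nonneg: "L2_norm u \<ge> 0"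
  unfolding L2_norm_def L2_inner_def set_lebesgue_integral_def
  by (intro real_sqrt_ge_zero Bochner_Integration.integral_nonneg) auto

lemma L2_inner_self: "u \<in> V \<Longrightarrow> L2_inner u u = (L2_norm u)\<^sup>2"
proof -
  assume u: "u \<in> V"
  have "L2_inner u u \<ge> 0"
    unfolding L2_inner_nodes[OF u u]
    by (intro sum_nonneg mult_nonneg_nonneg[OF _ zero_le_square])
      (auto intro!: divide_nonneg_nonneg less_imp_le[OF gauss_legendre_weight[OF gl]])
  then show ?thesis by (simp add: L2_norm_def)
qed

section \<open>The orthogonal nodal basis and the representation of linear functionals\<close>

definition nodal_basis :: "nat \<times> nat \<Rightarrow> real \<Rightarrow> real" where
  "nodal_basis z = DG_of (\<lambda>i. if i = fst z then lagrange k (cell_node i) (snd z) else 0)"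

abbreviation nodes :: "(nat \<times> nat) set" where "nodes \<equiv> {..<M} \<times> {..k}"

lemma nodal_basis_mem: "z \<in> nodes \<Longrightarrow> nodal_basis z \<in> V"
  unfolding nodal_basis_def by (intro DG_of_mem) (auto simp: degree_lagrange)

lemma nodal_basis_cell:
  "i < M \<Longrightarrow> x \<in> cell i \<Longrightarrow>
    nodal_basis (j, \<alpha>) x = (if i = j then poly (lagrange k (cell_node i) \<alpha>) x else 0)"
  by (simp add: nodal_basis_def DG_of_cell)

lemma nodal_basis_node:
  assumes "i < M" "\<beta> \<le> k" "\<alpha> \<le> k"
  shows "nodal_basis (j, \<alpha>) (cell_node i \<beta>) = (if (j, \<alpha>) = (i, \<beta>) then 1 else 0)"
  using assms poly_lagrange[OF cell_node_inj, of \<alpha> \<beta> i]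
  by (auto simp: nodal_basis_cell[OF assms(1) cell_node_mem])

lemma DG_expand:
  assumes "u \<in> V"
  shows "u = (\<lambda>x. \<Sum>z\<in>nodes. u (cell_node (fst z) (snd z)) * nodal_basis z x)"
proof (rule DG_eqI[OF assms])
  show "(\<lambda>x. \<Sum>z\<in>nodes. u (cell_node (fst z) (snd z)) * nodal_basis z x) \<in> V"
    by (intro DG_sum nodal_basis_mem) auto
  fix i x assume i: "i < M" and x: "x \<in> cell i"
  obtain p where p: "degree p \<le> k" "\<And>x. x \<in> cell i \<Longrightarrow> u x = poly p x"
    using DG_cell_poly[OF assms i] by metis
  have "(\<Sum>z\<in>nodes. u (cell_node (fst z) (snd z)) * nodal_basis z x)
      = (\<Sum>j<M. \<Sum>\<alpha>\<le>k. u (cell_node j \<alpha>) * nodal_basis (j, \<alpha>) x)"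
    by (simp add: sum.cartesian_product split_beta)
  also have "\<dots> = (\<Sum>j<M. if j = i then \<Sum>\<alpha>\<le>k. u (cell_node i \<alpha>) * poly (lagrange k (cell_node i) \<alpha>) x else 0)"
    by (intro sum.cong) (auto simp: nodal_basis_cell[OF i x])
  also have "\<dots> = (\<Sum>\<alpha>\<le>k. poly p (cell_node i \<alpha>) * poly (lagrange k (cell_node i) \<alpha>) x)"
    using i by (auto intro!: sum.cong simp: p(2)[OF cell_node_mem])
  also have "\<dots> = poly p x"
    using arg_cong[OF lagrange_interpolation[OF cell_node_inj[of i] p(1)], of "\<lambda>p. poly p x"]
    by (simp add: poly_sum)
  finally show "u x = (\<Sum>z\<in>nodes. u (cell_node (fst z) (snd z)) * nodal_basis z x)"
    using p(2)[OF x] by simp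
qed

lemma L2_inner_nodal_basis:
  assumes "u \<in> V" "i < M" "\<alpha> \<le> k"
  shows "L2_inner u (nodal_basis (i, \<alpha>)) = w \<alpha> / (2 * real M) * u (cell_node i \<alpha>)"
proof -
  have "L2_inner u (nodal_basis (i, \<alpha>)) =
      (\<Sum>j<M. \<Sum>\<beta>\<le>k. if j = i \<and> \<beta> = \<alpha> then w \<alpha> / (2 * real M) * u (cell_node i \<alpha>) else 0)"
    using assms(1) nodal_basis_mem[of "(i, \<alpha>)"] assms(2,3)
    by (subst L2_inner_nodes) (auto intro!: sum.cong simp: nodal_basis_node)
  also have "\<dots> = (\<Sum>j<M. if j = i then w \<alpha> / (2 * real M) * u (cell_node i \<alpha>) else 0)"
    using assms(3) by (intro sum.cong) auto
  finally show ?thesis using assms(2) by simp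
qed

text \<open>The projection and the scheme are both given by \<open>THE\<close>, so each calls for
  existence and uniqueness. Both represent a linear functional F, and an orthogonal basis makes the
  representing element explicit.\<close>

lemma DG_riesz:
  assumes add: "\<And>\<phi> \<psi>. \<phi> \<in> V \<Longrightarrow> \<psi> \<in> V \<Longrightarrow> F (\<lambda>x. \<phi> x + \<psi> x) = F \<phi> + F \<psi>"
    and scale: "\<And>\<phi> c. \<phi> \<in> V \<Longrightarrow> F (\<lambda>x. c * \<phi> x) = c * F \<phi>"
  shows "\<exists>!u. u \<in> V \<and> (\<forall>\<phi>\<in>V. L2_inner u \<phi> = F \<phi>)"
proof -
  have zero: "F (\<lambda>x. 0) = 0"
    using scale[OF DG_const[of 0], of 0] by simp
  have sum: "F (\<lambda>x. \<Sum>z\<in>Z. c z * e z x) = (\<Sum>z\<in>Z. c z * F (e z))"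
    if "finite Z" "\<And>z. z \<in> Z \<Longrightarrow> e z \<in> V" for Z :: "(nat \<times> nat) set" and c e
    using that by (induction Z) (simp_all add: zero add scale DG_scale DG_sum)
  have w0: "w \<alpha> \<noteq> 0" if "\<alpha> \<le> k" for \<alpha>
    using gauss_legendre_weight[OF gl that] by simp
  \<comment> \<open>The coefficient of a basis element e is F e divided by its squared norm w / (2
    M).\<close>
  define u where "u = (\<lambda>x. \<Sum>z\<in>nodes. (2 * real M / w (snd z) * F (nodal_basis z)) * nodal_basis z x)"
  have uV: "u \<in> V"
    unfolding u_def by (intro DG_sum nodal_basis_mem) auto
  have u_node: "u (cell_node i \<alpha>) = 2 * real M / w \<alpha> * F (nodal_basis (i, \<alpha>))" if "i < M" "\<alpha> \<le> k" for i \<alpha>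
  proof -
    have "u (cell_node i \<alpha>) =
        (\<Sum>z\<in>nodes. if z = (i, \<alpha>) then 2 * real M / w \<alpha> * F (nodal_basis (i, \<alpha>)) else 0)"
      unfolding u_def
      by (intro sum.cong refl) (use that in \<open>auto simp: nodal_basis_node split: if_splits\<close>)
    then show ?thesis using that by simp
  qed
  have riesz: "L2_inner u \<phi> = F \<phi>" if \<phi>: "\<phi> \<in> V" for \<phi>
  proof -
    have "L2_inner u \<phi> = (\<Sum>i<M. \<Sum>\<alpha>\<le>k. \<phi> (cell_node i \<alpha>) * F (nodal_basis (i, \<alpha>)))"
      unfolding L2_inner_nodes[OF uV \<phi>]
      by (intro sum.cong refl) (auto simp: u_node w0)
    also have "\<dots> = (\<Sum>z\<in>nodes. \<phi> (cell_node (fst z) (snd z)) * F (nodal_basis z))"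
      by (simp add: sum.cartesian_product split_beta)
    also have "\<dots> = F (\<lambda>x. \<Sum>z\<in>nodes. \<phi> (cell_node (fst z) (snd z)) * nodal_basis z x)"
      by (rule sum[symmetric]) (auto intro: nodal_basis_mem)
    finally show ?thesis using DG_expand[OF \<phi>] by simp
  qed
  show ?thesis
  proof (intro ex1I[of _ u] conjI ballI uV riesz)
    fix u' assume u': "u' \<in> V \<and> (\<forall>\<phi>\<in>V. L2_inner u' \<phi> = F \<phi>)"
    have "u' (cell_node i \<alpha>) = u (cell_node i \<alpha>)" if "i < M" "\<alpha> \<le> k" for i \<alpha>
      using L2_inner_nodal_basis[OF _ that, of u'] L2_inner_nodal_basis[OF uV that]
        u' riesz nodal_basis_mem[of "(i, \<alpha>)"] that w0[OF that(2)] by simp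
    then have "(\<lambda>x. \<Sum>z\<in>nodes. u' (cell_node (fst z) (snd z)) * nodal_basis z x) =
        (\<lambda>x. \<Sum>z\<in>nodes. u (cell_node (fst z) (snd z)) * nodal_basis z x)"
      by (intro ext sum.cong) auto
    then show "u' = u"
      using DG_expand[OF uV] DG_expand[of u'] u' by simp
  qed
qed

lemma DG_proj_mem:
  assumes f: "continuous_on UNIV f"
  shows "DG_proj k M f \<in> V"
proof -
  have integrable: "set_integrable lborel {0<..<1} (\<lambda>x. f x * \<phi> x)" if \<phi>: "\<phi> \<in> V" for \<phi>
  proof -
    obtain p where p: "\<And>i x. i < M \<Longrightarrow> x \<in> cell i \<Longrightarrow> \<phi> x = poly (p i) x"
      using DG_polys[OF \<phi>] by metis
    show ?thesis
      by (rule piecewise_set_integrable[OF M, of "\<lambda>i x. f x * poly (p i) x"])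
        (auto simp: p intro!: continuous_intros f)
  qed
  have integrable_DG: "set_integrable lborel {0<..<1} (\<lambda>x. u x * \<phi> x)" if u: "u \<in> V" and \<phi>: "\<phi> \<in> V" for u \<phi>
  proof -
    obtain p where p: "\<And>i x. i < M \<Longrightarrow> x \<in> cell i \<Longrightarrow> u x = poly (p i) x"
      using DG_polys[OF u] by metis
    obtain q where q: "\<And>i x. i < M \<Longrightarrow> x \<in> cell i \<Longrightarrow> \<phi> x = poly (q i) x"
      using DG_polys[OF \<phi>] by metis
    show ?thesis
      by (rule piecewise_set_integrable[OF M, of "\<lambda>i x. poly (p i) x * poly (q i) x"])
        (auto simp: p q intro!: continuous_intros)
  qed
  \<comment> \<open>\<open>DG_proj\<close> tests the difference f - u. Splitting it into a
    functional of f and an inner product inside V rests on the integrability of both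
    products.\<close>
  have eq: "L2_inner (\<lambda>x. f x - u x) \<phi> = L2_inner f \<phi> - L2_inner u \<phi>" if "u \<in> V" "\<phi> \<in> V" for u \<phi>
    unfolding L2_inner_def left_diff_distrib
    by (rule set_integral_diff(2)[OF integrable[OF that(2)] integrable_DG[OF that]])
  have "\<exists>!u. u \<in> V \<and> (\<forall>\<phi>\<in>V. L2_inner u \<phi> = L2_inner f \<phi>)"
  proof (rule DG_riesz)
    show "L2_inner f (\<lambda>x. \<phi> x + \<psi> x) = L2_inner f \<phi> + L2_inner f \<psi>" if "\<phi> \<in> V" "\<psi> \<in> V" for \<phi> \<psi>
      unfolding L2_inner_def distrib_left
      by (rule set_integral_add(2)[OF integrable[OF that(1)] integrable[OF that(2)]])
    show "L2_inner f (\<lambda>x. c * \<phi> x) = c * L2_inner f \<phi>" if "\<phi> \<in> V" for c \<phi>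
      by (simp add: L2_inner_def mult.left_commute[of _ c])
  qed
  then have "\<exists>!u. u \<in> V \<and> (\<forall>\<phi>\<in>V. L2_inner (\<lambda>x. f x - u x) \<phi> = 0)"
    by (rule back_subst[of Ex1]) (auto simp: eq fun_eq_iff)
  from theI'[OF this] show ?thesis
    unfolding DG_proj_def by blast
qed

end

section \<open>The quadrature on the subcells\<close>

lemma sum_integral_adjacent:
  fixes X :: "nat \<Rightarrow> real" and f :: "real \<Rightarrow> real"
  assumes f: "\<And>a b. f integrable_on {a..b}" and X: "\<And>q. q < n \<Longrightarrow> X q \<le> X (Suc q)"
  shows "(\<Sum>q<n. integral {X q..X (Suc q)} f) = integral {X 0..X n} f"
proof -
  have "m \<le> n \<Longrightarrow> X 0 \<le> X m \<and> (\<Sum>q<m. integral {X q..X (Suc q)} f) = integral {X 0..X m} f" for m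
  proof (induction m)
    case (Suc m)
    then have "X 0 \<le> X m" "X m \<le> X (Suc m)" using X[of m] by auto
    with Suc Henstock_Kurzweil_Integration.integral_combine[OF this f] show ?case by simp
  qed simp
  then show ?thesis by blast
qed

text \<open>Everything that the analysis of one step uses of the flow: two-sided Lipschitz bounds
  with factors exp (- \<rho>) and exp \<rho>, continuity, and compatibility with the period. It is
  instantiated later with \<rho> = L \<tau>.\<close>

locale dg_step = dg_mesh +
  fixes y :: "real \<Rightarrow> real \<Rightarrow> real" and \<tau> \<rho> :: real
  assumes \<rho>: "\<rho> \<ge> 0"
    and Y_lower: "\<And>x z. x \<le> z \<Longrightarrow> (z - x) * exp (- \<rho>) \<le> y z (- \<tau>) - y x (- \<tau>)"
    and Y_upper: "\<And>x z. x \<le> z \<Longrightarrow> y z (- \<tau>) - y x (- \<tau>) \<le> (z - x) * exp \<rho>"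
    and Y_cont: "continuous_on UNIV (\<lambda>x. y x (- \<tau>))"
    and Y_plus_1: "\<And>x. y (x + 1) (- \<tau>) = y x (- \<tau>) + 1"
begin

abbreviation Y :: "real \<Rightarrow> real" where "Y x \<equiv> y x (- \<tau>)"

lemma Y_less: "x < z \<Longrightarrow> Y x < Y z"
proof -
  assume "x < z"
  then have "0 < (z - x) * exp (- \<rho>)" by simp
  with Y_lower[of x z] \<open>x < z\<close> show ?thesis by linarith
qed

lemma Y_le: "x \<le> z \<Longrightarrow> Y x \<le> Y z"
  using Y_less[of x z] by (cases "x = z") auto

abbreviation S :: "nat \<Rightarrow> real set" where "S i \<equiv> node_preimages y \<tau> M i"
abbreviation p :: "nat \<Rightarrow> nat" where "p i \<equiv> card (S i)"
abbreviation X :: "nat \<Rightarrow> nat \<Rightarrow> real" where "X i q \<equiv> breakpoints y \<tau> M i ! q"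

text \<open>Y is strictly increasing, so a point is determined by the index of the node it is
  carried to, and these indices lie between bounds given by the images of the two cell ends.
  Finiteness makes \<open>sorted_list_of_set\<close> list the points faithfully.\<close>

lemma finite_node_preimages: "finite (S i)"
proof (rule finite_imageD)
  let ?J = "{\<lfloor>real M * Y (real i / real M)\<rfloor>..\<lfloor>real M * Y (real (Suc i) / real M)\<rfloor>}"
  have "\<lfloor>real M * Y x\<rfloor> \<in> ?J" if "x \<in> S i" for x
    using that Y_le[of "real i / real M" x] Y_le[of x "real (Suc i) / real M"]
    unfolding node_preimages_def by (auto intro!: floor_mono mult_left_mono)
  then have "(\<lambda>x. \<lfloor>real M * Y x\<rfloor>) ` S i \<subseteq> ?J" by blast
  then show "finite ((\<lambda>x. \<lfloor>real M * Y x\<rfloor>) ` S i)"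
    using finite_atLeastAtMost_int by (rule finite_subset)
  show "inj_on (\<lambda>x. \<lfloor>real M * Y x\<rfloor>) (S i)"
  proof (rule inj_onI)
    fix x z assume "x \<in> S i" "z \<in> S i" and eq: "\<lfloor>real M * Y x\<rfloor> = \<lfloor>real M * Y z\<rfloor>"
    then obtain j l :: int where "Y x = j / real M" "Y z = l / real M"
      unfolding node_preimages_def by blast
    with eq have "Y x = Y z" by simp
    then show "x = z" using Y_less[of x z] Y_less[of z x] by linarith
  qed
qed

lemma breakpoints_length: "length (breakpoints y \<tau> M i) = Suc (Suc (p i))"
  using finite_node_preimages by (simp add: breakpoints_def)

lemma breakpoints_first [simp]: "X i 0 = real i / real M"
  by (simp add: breakpoints_def)

lemma breakpoints_last [simp]: "X i (Suc (p i)) = real (Suc i) / real M"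
  using finite_node_preimages[of i] by (simp add: breakpoints_def nth_append)

lemma breakpoints_sorted: "sorted_wrt (<) (breakpoints y \<tau> M i)"
proof -
  have "real i / real M < x" "x < real (Suc i) / real M" if "x \<in> S i" for x
    using that by (auto simp: node_preimages_def)
  then show ?thesis
    using finite_node_preimages[of i] cell_less[of i]
    by (auto simp: breakpoints_def sorted_wrt_append)
qed

lemma breakpoints_less: "q < r \<Longrightarrow> r \<le> Suc (p i) \<Longrightarrow> X i q < X i r"
  by (rule sorted_wrt_nth_less[OF breakpoints_sorted]) (simp_all add: breakpoints_length)

lemma breakpoints_mono: "q \<le> r \<Longrightarrow> r \<le> Suc (p i) \<Longrightarrow> X i q \<le> X i r"
  using breakpoints_less[of q r i] by (cases "q = r") auto

lemma breakpoints_step: "q \<le> p i \<Longrightarrow> X i q < X i (Suc q)"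
  by (rule breakpoints_less) auto

lemma breakpoints_ge: "q \<le> Suc (p i) \<Longrightarrow> real i / real M \<le> X i q"
  using breakpoints_less[of 0 q i] by (cases q) auto

lemma breakpoints_le: "q \<le> Suc (p i) \<Longrightarrow> X i q \<le> real (Suc i) / real M"
  using breakpoints_less[of q "Suc (p i)" i] by (cases "q = Suc (p i)") auto

lemma breakpoints_gap:
  assumes "q \<le> p i" "X i q < x" "x < X i (Suc q)"
  shows "x \<notin> S i"
proof
  assume "x \<in> S i"
  then have "x \<in> set (breakpoints y \<tau> M i)"
    using finite_node_preimages[of i] by (simp add: breakpoints_def)
  then obtain r where r: "r \<le> Suc (p i)" "x = X i r"
    by (auto simp: in_set_conv_nth breakpoints_length less_Suc_eq_le)
  have "q < r"
    using breakpoints_mono[of r q i] assms(1,2) r by (intro not_le_imp_less notI) auto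
  moreover have "r < Suc q"
    using breakpoints_mono[of "Suc q" r i] assms(3) r by (intro not_le_imp_less notI) auto
  ultimately show False by simp
qed

definition qpt :: "nat \<Rightarrow> nat \<Rightarrow> nat \<Rightarrow> real" where
  "qpt i q \<alpha> = quad_point \<xi> (breakpoints y \<tau> M i) q \<alpha>"

lemma qpt_alt: "qpt i q \<alpha> = (X i q + X i (Suc q)) / 2 + \<xi> \<alpha> * ((X i (Suc q) - X i q) / 2)"
  by (simp add: qpt_def quad_point_def)

lemma qpt_between:
  assumes "q \<le> p i" "\<alpha> \<le> k"
  shows "X i q < qpt i q \<alpha>" "qpt i q \<alpha> < X i (Suc q)"
  unfolding qpt_alt by (rule affine_node_between[OF assms(2) breakpoints_step[OF assms(1)]])+

lemma qpt_cell: "q \<le> p i \<Longrightarrow> \<alpha> \<le> k \<Longrightarrow> qpt i q \<alpha> \<in> cell i"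
  using qpt_between[of q i \<alpha>] breakpoints_ge[of q i] breakpoints_le[of "Suc q" i] by simp

abbreviation G :: "(real \<Rightarrow> real) \<Rightarrow> (real \<Rightarrow> real) \<Rightarrow> real" where
  "G f g \<equiv> gauss_inner k \<xi> w y \<tau> M f g"

lemma G_alt: "G f g = (\<Sum>i<M. \<Sum>q\<le>p i. \<Sum>\<alpha>\<le>k.
    w \<alpha> / 2 * (X i (Suc q) - X i q) * f (qpt i q \<alpha>) * g (qpt i q \<alpha>))"
  by (simp add: gauss_inner_def Let_def quad_weight_def qpt_def)

text \<open>On every subcell the product is still a polynomial of degree at most 2 k, so the rule
  integrates it exactly and the adjacent integrals add up to the cell.\<close>

lemma G_DG:
  assumes "u \<in> V" "v \<in> V"
  shows "G u v = L2_inner u v"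
proof -
  obtain r where r: "\<And>i. i < M \<Longrightarrow> degree (r i) \<le> k" "\<And>i x. i < M \<Longrightarrow> x \<in> cell i \<Longrightarrow> u x = poly (r i) x"
    using DG_polys[OF assms(1)] by metis
  obtain s where s: "\<And>i. i < M \<Longrightarrow> degree (s i) \<le> k" "\<And>i x. i < M \<Longrightarrow> x \<in> cell i \<Longrightarrow> v x = poly (s i) x"
    using DG_polys[OF assms(2)] by metis
  have "G u v = (\<Sum>i<M. integral {real i / real M..real (Suc i) / real M} (poly (r i * s i)))"
    unfolding G_alt
  proof (intro sum.cong refl)
    fix i assume "i \<in> {..<M}"
    then have i: "i < M" by simp
    have deg: "degree (r i * s i) \<le> 2 * k + 1"
      using degree_mult_le[of "r i" "s i"] r(1)[OF i] s(1)[OF i] by linarith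
    have "(\<Sum>q\<le>p i. \<Sum>\<alpha>\<le>k. w \<alpha> / 2 * (X i (Suc q) - X i q) * u (qpt i q \<alpha>) * v (qpt i q \<alpha>))
        = (\<Sum>q\<le>p i. integral {X i q..X i (Suc q)} (poly (r i * s i)))"
    proof (intro sum.cong refl)
      fix q assume "q \<in> {..p i}"
      then have q: "q \<le> p i" by simp
      have "(\<Sum>\<alpha>\<le>k. w \<alpha> / 2 * (X i (Suc q) - X i q) * u (qpt i q \<alpha>) * v (qpt i q \<alpha>))
          = (\<Sum>\<alpha>\<le>k. w \<alpha> / 2 * (X i (Suc q) - X i q) * poly (r i * s i) (qpt i q \<alpha>))"
        using r(2)[OF i] s(2)[OF i] qpt_cell[OF q] by (intro sum.cong refl) simp
      then show "(\<Sum>\<alpha>\<le>k. w \<alpha> / 2 * (X i (Suc q) - X i q) * u (qpt i q \<alpha>) * v (qpt i q \<alpha>))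
          = integral {X i q..X i (Suc q)} (poly (r i * s i))"
        using gauss_legendre_interval[OF gl breakpoints_step[OF q] deg] by (simp only: qpt_alt)
    qed
    also have "\<dots> = integral {X i 0..X i (Suc (p i))} (poly (r i * s i))"
      unfolding lessThan_Suc_atMost[symmetric]
      by (rule sum_integral_adjacent)
        (auto intro!: integrable_continuous_real continuous_intros less_imp_le[OF breakpoints_step]
          simp: less_Suc_eq_le)
    finally show "(\<Sum>q\<le>p i. \<Sum>\<alpha>\<le>k. w \<alpha> / 2 * (X i (Suc q) - X i q) * u (qpt i q \<alpha>) * v (qpt i q \<alpha>))
        = integral {real i / real M..real (Suc i) / real M} (poly (r i * s i))"
      by simp
  qed
  also have "\<dots> = L2_inner u v"
    by (rule L2_inner_DG[OF r s, symmetric])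
  finally show ?thesis .
qed

section \<open>The discrete inner product as a Euclidean one\<close>

definition quad_index :: "(nat \<times> nat \<times> nat) set" where
  "quad_index = (SIGMA i:{..<M}. SIGMA q:{..p i}. {..k})"

definition quad_scaled :: "(real \<Rightarrow> real) \<Rightarrow> nat \<times> nat \<times> nat \<Rightarrow> real" where
  "quad_scaled f = (\<lambda>(i, q, \<alpha>). sqrt (w \<alpha> / 2 * (X i (Suc q) - X i q)) * f (qpt i q \<alpha>))"

text \<open>Scaling by the roots of the weights makes the norm lemmas for \<open>L2_set\<close> applicable.\<close>

lemma G_euclidean: "G f g = (\<Sum>z\<in>quad_index. quad_scaled f z * quad_scaled g z)"
proof -
  have "G f g = (\<Sum>i<M. \<Sum>q\<le>p i. \<Sum>\<alpha>\<le>k. quad_scaled f (i, q, \<alpha>) * quad_scaled g (i, q, \<alpha>))"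
    unfolding G_alt
  proof (intro sum.cong refl)
    fix i q \<alpha> assume "q \<in> {..p i}" "\<alpha> \<in> {..k}"
    then have "0 \<le> w \<alpha> / 2 * (X i (Suc q) - X i q)"
      using gauss_legendre_weight[OF gl, of \<alpha>] breakpoints_step[of q i]
      by (intro mult_nonneg_nonneg) auto
    then have "w \<alpha> / 2 * (X i (Suc q) - X i q) =
        sqrt (w \<alpha> / 2 * (X i (Suc q) - X i q)) * sqrt (w \<alpha> / 2 * (X i (Suc q) - X i q))"
      by simp
    then show "w \<alpha> / 2 * (X i (Suc q) - X i q) * f (qpt i q \<alpha>) * g (qpt i q \<alpha>)
        = quad_scaled f (i, q, \<alpha>) * quad_scaled g (i, q, \<alpha>)"
      unfolding quad_scaled_def by (simp only: prod.case mult_ac)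
  qed
  then show ?thesis
    unfolding quad_index_def by (simp add: sum.Sigma split_beta)
qed

definition Gnorm :: "(real \<Rightarrow> real) \<Rightarrow> real" where
  "Gnorm f = L2_set (quad_scaled f) quad_index"

lemma Gnorm_nonneg: "Gnorm f \<ge> 0"
  by (simp add: Gnorm_def)

lemma Gnorm_square: "(Gnorm f)\<^sup>2 = G f f"
  by (simp add: Gnorm_def L2_set_def G_euclidean sum_nonneg power2_eq_square)

lemma G_le_Gnorm: "G f g \<le> Gnorm f * Gnorm g"
proof -
  have "G f g \<le> (\<Sum>z\<in>quad_index. \<bar>quad_scaled f z\<bar> * \<bar>quad_scaled g z\<bar>)"
    unfolding G_euclidean by (intro sum_mono) (metis abs_ge_self abs_mult)
  also have "\<dots> \<le> Gnorm f * Gnorm g"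
    unfolding Gnorm_def by (rule L2_set_mult_ineq)
  finally show ?thesis .
qed

lemma quad_scaled_add: "quad_scaled (\<lambda>x. f x + g x) z = quad_scaled f z + quad_scaled g z"
  by (simp add: quad_scaled_def split_beta distrib_left)

lemma quad_scaled_scale: "quad_scaled (\<lambda>x. c * f x) z = c * quad_scaled f z"
  by (simp add: quad_scaled_def split_beta)

lemma Gnorm_add: "Gnorm (\<lambda>x. f x + g x) \<le> Gnorm f + Gnorm g"
  unfolding Gnorm_def quad_scaled_add by (rule L2_set_triangle_ineq)

lemma G_add_left: "G (\<lambda>x. f x + g x) h = G f h + G g h"
  by (simp add: G_euclidean quad_scaled_add distrib_right sum.distrib)

lemma G_add_right: "G h (\<lambda>x. f x + g x) = G h f + G h g"
  by (simp add: G_euclidean quad_scaled_add distrib_left sum.distrib)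

lemma G_scale_left: "G (\<lambda>x. c * f x) g = c * G f g"
  by (simp add: G_euclidean quad_scaled_scale sum_distrib_left mult.assoc)

lemma G_scale_right: "G f (\<lambda>x. c * g x) = c * G f g"
  by (simp add: G_euclidean quad_scaled_scale sum_distrib_left mult.left_commute)

lemma Gnorm_DG: "u \<in> V \<Longrightarrow> Gnorm u = L2_norm u"
  using Gnorm_square[of u] Gnorm_nonneg[of u] G_DG[of u u]
  by (simp add: L2_norm_def real_sqrt_unique)

lemma L2_norm_const: "L2_norm (\<lambda>x. c) = \<bar>c\<bar>"
  by (simp add: L2_norm_def L2_inner_def set_lebesgue_integral_def)

text \<open>Compare with the constant function \<delta>: it lies in V, so its discrete norm is its
  L2 norm on an interval of length one.\<close>

lemma Gnorm_bound:
  assumes "\<And>x. \<bar>f x\<bar> \<le> \<delta>"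
  shows "Gnorm f \<le> \<delta>"
proof -
  have "0 \<le> \<delta>" using assms[of 0] by linarith
  have "Gnorm f \<le> Gnorm (\<lambda>x. \<delta>)"
    unfolding Gnorm_def L2_set_def
  proof (intro real_sqrt_le_mono sum_mono abs_le_square_iff[THEN iffD1])
    fix z show "\<bar>quad_scaled f z\<bar> \<le> \<bar>quad_scaled (\<lambda>x. \<delta>) z\<bar>"
      using assms \<open>0 \<le> \<delta>\<close> by (auto simp: quad_scaled_def split_beta abs_mult intro!: mult_left_mono)
  qed
  also have "\<dots> = \<delta>"
    using Gnorm_DG[OF DG_const] \<open>0 \<le> \<delta>\<close> by (simp add: L2_norm_const)
  finally show ?thesis .
qed

lemma SL_step_DG:
  shows "SL_step k \<xi> w y \<tau> M u \<in> V"
    and "\<phi> \<in> V \<Longrightarrow> L2_inner (SL_step k \<xi> w y \<tau> M u) \<phi> = G (\<lambda>x. u (Y x)) \<phi>"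
proof -
  have "\<exists>!u'. u' \<in> V \<and> (\<forall>\<phi>\<in>V. L2_inner u' \<phi> = G (\<lambda>x. u (Y x)) \<phi>)"
    by (rule DG_riesz) (rule G_add_right G_scale_right)+
  from theI'[OF this]
  show "SL_step k \<xi> w y \<tau> M u \<in> V"
    and "\<phi> \<in> V \<Longrightarrow> L2_inner (SL_step k \<xi> w y \<tau> M u) \<phi> = G (\<lambda>x. u (Y x)) \<phi>"
    unfolding SL_step_def by blast+
qed

end

section \<open>Stability of a time step\<close>

text \<open>An interval without interior nodes lies in an integer translate of a single mesh cell,
  and periodicity carries the polynomial of that cell over.\<close>

lemma (in dg_mesh) DG_poly_between_nodes:
  assumes u: "u \<in> V" and "a < c" and no_node: "\<And>j :: int. \<not> (a < j / real M \<and> j / real M < c)"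
  obtains r where "degree r \<le> k" "\<And>x. a < x \<Longrightarrow> x < c \<Longrightarrow> u x = poly r x"
proof -
  \<comment> \<open>The index of the last node not beyond a. Division by M splits it into the number
    n of the period and the cell i of the unit interval.\<close>
  define j where "j = \<lfloor>a * real M\<rfloor>"
  define n where "n = j div int M"
  define i where "i = nat (j mod int M)"
  have "0 \<le> j mod int M" "j mod int M < int M" by simp_all
  then have i: "i < M" "int i = j mod int M" unfolding i_def by linarith+
  have j: "j = n * int M + int i" unfolding n_def i(2) by simp
  have 1: "of_int j \<le> a * real M" "a * real M < of_int j + 1"
    unfolding j_def by linarith+
  then have "a < of_int (j + 1) / real M" by (simp add: field_simps)
  with no_node[of "j + 1"] have 2: "c \<le> of_int (j + 1) / real M" by linarith
  have 3: "of_int j / real M \<le> a" using 1(1) by (simp add: field_simps)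
  have jM: "of_int j / real M = real i / real M + of_int n"
    "of_int (j + 1) / real M = real (Suc i) / real M + of_int n"
    unfolding j by (simp_all add: field_simps)
  obtain r where r: "degree r \<le> k" "\<And>x. x \<in> cell i \<Longrightarrow> u x = poly r x"
    using DG_cell_poly[OF u i(1)] by metis
  show ?thesis
  proof (rule that[of "r \<circ>\<^sub>p [:- of_int n, 1:]"])
    show "degree (r \<circ>\<^sub>p [:- of_int n, 1:]) \<le> k"
      using r(1) by (simp add: degree_pcompose)
    fix x assume "a < x" "x < c"
    then have "x - of_int n \<in> cell i"
      using 2 3 unfolding jM by simp
    then have "u (x - of_int n) = poly r (x - of_int n)" by (rule r(2))
    then show "u x = poly (r \<circ>\<^sub>p [:- of_int n, 1:]) x"
      using periodic1_of_int[OF DG_periodic[OF u], of "x - of_int n" n]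
      by (simp add: poly_pcompose algebra_simps)
  qed
qed

lemma (in dg_mesh) DG_square_has_integral:
  assumes "u \<in> V"
  shows "((\<lambda>x. u x * u x) has_integral L2_inner u u) {0..1}"
proof -
  obtain p where p: "\<And>i x. i < M \<Longrightarrow> x \<in> cell i \<Longrightarrow> u x = poly (p i) x"
    using DG_polys[OF assms] by metis
  let ?h = "\<lambda>i x. poly (p i) x * poly (p i) x"
  have "((\<lambda>x. u x * u x) has_integral
      (\<Sum>i<M. integral {real i / real M..real (Suc i) / real M} (?h i))) {0..1}"
    by (rule piecewise_has_integral[OF M]) (auto simp: p intro!: continuous_intros)
  moreover have "L2_inner u u = (\<Sum>i<M. integral {real i / real M..real (Suc i) / real M} (?h i))"
    by (rule L2_inner_piecewise) (auto simp: p intro!: continuous_intros)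
  ultimately show ?thesis by simp
qed

text \<open>Names the inverse estimate, so that one K, depending on k and the rule alone, can be
  fixed before N and M.\<close>

definition gauss_lipschitz_const :: "nat \<Rightarrow> (nat \<Rightarrow> real) \<Rightarrow> (nat \<Rightarrow> real) \<Rightarrow> real \<Rightarrow> bool" where
  "gauss_lipschitz_const k \<xi> w K \<longleftrightarrow> K \<ge> 0 \<and>
    (\<forall>p s s'. degree p \<le> k \<longrightarrow> s \<in> {-1..1} \<longrightarrow> s' \<in> {-1..1} \<longrightarrow>
      \<bar>(poly p s)\<^sup>2 - (poly p s')\<^sup>2\<bar> \<le> K * \<bar>s - s'\<bar> * (\<Sum>\<alpha>\<le>k. w \<alpha> * (poly p (\<xi> \<alpha>))\<^sup>2))"

context dg_step
begin

text \<open>By the intermediate value theorem such a node would be the image of an interior point of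
  the subcell, and that point would itself be a breakpoint.\<close>

lemma Y_no_node:
  assumes i: "i < M" and q: "q \<le> p i" and j: "Y (X i q) < of_int j / real M" "of_int j / real M < Y (X i (Suc q))"
  shows False
proof -
  have "\<exists>x\<ge>X i q. x \<le> X i (Suc q) \<and> Y x = of_int j / real M"
    by (rule IVT') (use j breakpoints_step[OF q] in \<open>auto intro: continuous_on_subset[OF Y_cont]\<close>)
  then obtain x where x: "X i q \<le> x" "x \<le> X i (Suc q)" "Y x = of_int j / real M" by blast
  have "x \<noteq> X i q" "x \<noteq> X i (Suc q)" using x(3) j by auto
  then have x': "X i q < x" "x < X i (Suc q)" using x by auto
  then have "x \<in> S i"
    using x(3) breakpoints_ge[of q i] breakpoints_le[of "Suc q" i] q unfolding node_preimages_def by auto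
  then show False using breakpoints_gap[OF q x'] by simp
qed

lemma gauss_weights_sum: "(\<Sum>\<alpha>\<le>k. w \<alpha>) = 2"
proof -
  have "poly [:1:] = (\<lambda>x :: real. 1)" by auto
  then show ?thesis
    using gauss_legendre_interval[OF gl, of "-1" 1 "[:1:]"] by simp
qed

text \<open>Measured from Y a, both values lie between l (c - a) exp (- \<rho>) and l (c - a) exp
  \<rho>, where l in (0, 1) is the relative position of the point in [a, c]. Their distance is at
  most the width of that range.\<close>

lemma Y_affine_dist:
  assumes "a < c" "\<alpha> \<le> k"
  shows "\<bar>Y ((a + c) / 2 + \<xi> \<alpha> * ((c - a) / 2)) - ((Y a + Y c) / 2 + \<xi> \<alpha> * ((Y c - Y a) / 2))\<bar>
    \<le> (exp \<rho> - exp (- \<rho>)) * (c - a)"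
proof -
  define l where "l = (1 + \<xi> \<alpha>) / 2"
  define x where "x = (a + c) / 2 + \<xi> \<alpha> * ((c - a) / 2)"
  have l: "0 < l" "l < 1" using gauss_legendre_node[OF gl assms(2)] by (auto simp: l_def)
  have x: "x - a = l * (c - a)" by (simp add: x_def l_def field_simps)
  have "a \<le> x" using l assms(1) x by (metis diff_ge_0_iff_ge less_imp_le mult_nonneg_nonneg)
  have 1: "l * (c - a) * exp (- \<rho>) \<le> Y x - Y a" "Y x - Y a \<le> l * (c - a) * exp \<rho>"
    using Y_lower[OF \<open>a \<le> x\<close>] Y_upper[OF \<open>a \<le> x\<close>] unfolding x by auto
  have 2: "l * ((c - a) * exp (- \<rho>)) \<le> l * (Y c - Y a)" "l * (Y c - Y a) \<le> l * ((c - a) * exp \<rho>)"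
    using Y_lower[of a c] Y_upper[of a c] assms(1) l by (auto intro!: mult_left_mono)
  have "\<bar>(Y x - Y a) - l * (Y c - Y a)\<bar> \<le> l * ((c - a) * (exp \<rho> - exp (- \<rho>)))"
    using 1 2 by (simp add: abs_le_iff algebra_simps)
  also have "\<dots> \<le> 1 * ((c - a) * (exp \<rho> - exp (- \<rho>)))"
    using l assms(1) \<rho> by (intro mult_right_mono mult_nonneg_nonneg) auto
  also have "(Y x - Y a) - l * (Y c - Y a) = Y x - ((Y a + Y c) / 2 + \<xi> \<alpha> * ((Y c - Y a) / 2))"
    by (simp add: l_def field_simps)
  finally show ?thesis unfolding x_def by (simp add: mult.commute)
qed

text \<open>On a subcell the composition with \<open>Y\<close> is compared with the composition with the affine map
  that agrees with \<open>Y\<close> at the end points; for the latter the quadrature is exact.\<close>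

lemma subcell_stability:
  assumes K: "gauss_lipschitz_const k \<xi> w K" and u: "u \<in> V" and i: "i < M" and q: "q \<le> p i"
  shows "(\<Sum>\<alpha>\<le>k. w \<alpha> / 2 * (X i (Suc q) - X i q) * u (Y (qpt i q \<alpha>)) * u (Y (qpt i q \<alpha>)))
    \<le> exp \<rho> * (1 + 4 * K * (exp (2 * \<rho>) - 1)) * integral {Y (X i q)..Y (X i (Suc q))} (\<lambda>x. u x * u x)"
proof -
  define a c where "a = X i q" and "c = X i (Suc q)"
  have ac: "a < c" unfolding a_def c_def by (rule breakpoints_step[OF q])
  define d where "d = Y c - Y a"
  have d: "d > 0" using Y_less[OF ac] by (simp add: d_def)
  \<comment> \<open>The lower Lipschitz bound read backwards. Replacing the length of the subcell by
    that of its image produces the factor exp \<rho> in the final constant.\<close>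
  have cad: "c - a \<le> d * exp \<rho>"
  proof -
    have "(c - a) * exp (- \<rho>) * exp \<rho> \<le> d * exp \<rho>"
      unfolding d_def using Y_lower[of a c] ac by (intro mult_right_mono) auto
    then show ?thesis by (simp add: mult.assoc flip: exp_add)
  qed
  have "\<not> (Y a < of_int j / real M \<and> of_int j / real M < Y c)" for j
    using Y_no_node[OF i q, of j] unfolding a_def c_def by blast
  then obtain r where r: "degree r \<le> k" "\<And>x. Y a < x \<Longrightarrow> x < Y c \<Longrightarrow> u x = poly r x"
    using DG_poly_between_nodes[OF u Y_less[OF ac]] by metis
  define m where "m = (Y a + Y c) / 2"
  \<comment> \<open>The polynomial in reference coordinates: on [-1, 1] the constant K applies
    regardless of the length of the interval.\<close>
  define s where "s = r \<circ>\<^sub>p [:m, d / 2:]"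
  have s: "poly s t = poly r (m + t * (d / 2))" for t
    by (simp add: s_def poly_pcompose)
  have degs: "degree s \<le> k" using r(1) d by (simp add: s_def degree_pcompose)
  define R where "R = (\<Sum>\<alpha>\<le>k. w \<alpha> * (poly s (\<xi> \<alpha>))\<^sup>2)"
  have w: "0 < w \<alpha>" if "\<alpha> \<le> k" for \<alpha> using gauss_legendre_weight[OF gl that] .
  have R0: "R \<ge> 0" unfolding R_def by (intro sum_nonneg mult_nonneg_nonneg) (use w in \<open>auto simp: less_imp_le\<close>)
  have "degree (r * r) \<le> 2 * k + 1" using degree_mult_le[of r r] r(1) by linarith
  from gauss_legendre_interval[OF gl Y_less[OF ac] this]
  have "integral {Y a..Y c} (poly (r * r)) = (\<Sum>\<alpha>\<le>k. d / 2 * (w \<alpha> * (poly s (\<xi> \<alpha>))\<^sup>2))"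
    by (simp add: s d_def m_def power2_eq_square mult_ac)
  also have "\<dots> = d / 2 * R" by (simp add: R_def sum_distrib_left)
  also have "integral {Y a..Y c} (poly (r * r)) = integral {Y a..Y c} (\<lambda>x. u x * u x)"
    by (rule integral_spike[of "{Y a, Y c}"]) (auto simp: r(2))
  finally have int: "integral {Y a..Y c} (\<lambda>x. u x * u x) = d / 2 * R" .
  \<comment> \<open>K times the bound 2 (exp (2 \<rho>) - 1), derived below, for the displacement of
    a node in reference coordinates.\<close>
  define E where "E = K * (2 * (exp (2 * \<rho>) - 1))"
  have E0: "E \<ge> 0" using K \<rho> by (simp add: E_def gauss_lipschitz_const_def)
  have pt: "u (Y (qpt i q \<alpha>)) * u (Y (qpt i q \<alpha>)) \<le> (poly s (\<xi> \<alpha>))\<^sup>2 + E * R" if \<alpha>: "\<alpha> \<le> k" for \<alpha>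
  proof -
    define x where "x = qpt i q \<alpha>"
    have x: "a < x" "x < c" unfolding x_def a_def c_def by (rule qpt_between[OF q \<alpha>])+
    have Yx: "Y a < Y x" "Y x < Y c" using x Y_less by auto
    define t where "t = (Y x - m) / (d / 2)"
    have t_eq: "m + t * (d / 2) = Y x"
    proof -
      have "t * d = 2 * (Y x - m)" using d by (simp add: t_def)
      then show ?thesis by (simp add: field_simps)
    qed
    have ux: "u (Y x) = poly s t" using r(2)[OF Yx] unfolding s t_eq .
    have t: "t \<in> {-1..1}"
      using Yx d unfolding t_def m_def d_def by (simp add: field_simps)
    have "\<bar>Y x - (m + \<xi> \<alpha> * (d / 2))\<bar> \<le> (exp \<rho> - exp (- \<rho>)) * (c - a)"
      using Y_affine_dist[OF ac \<alpha>] unfolding x_def qpt_alt a_def[symmetric] c_def[symmetric] m_def d_def .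
    also have "\<dots> \<le> (exp \<rho> - exp (- \<rho>)) * (d * exp \<rho>)"
      using cad \<rho> by (intro mult_left_mono) auto
    also have "\<dots> = (exp (2 * \<rho>) - 1) * d"
      by (simp add: algebra_simps exp_minus flip: exp_add)
    also have "Y x - (m + \<xi> \<alpha> * (d / 2)) = (t - \<xi> \<alpha>) * (d / 2)"
      unfolding t_eq[symmetric] left_diff_distrib by linarith
    finally have "\<bar>(t - \<xi> \<alpha>) * (d / 2)\<bar> \<le> (exp (2 * \<rho>) - 1) * d" .
    then have "\<bar>t - \<xi> \<alpha>\<bar> * d \<le> 2 * (exp (2 * \<rho>) - 1) * d"
      using d by (simp add: abs_mult)
    then have dist: "\<bar>t - \<xi> \<alpha>\<bar> \<le> 2 * (exp (2 * \<rho>) - 1)" using d by simp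
    have "\<bar>(poly s t)\<^sup>2 - (poly s (\<xi> \<alpha>))\<^sup>2\<bar> \<le> K * \<bar>t - \<xi> \<alpha>\<bar> * R"
      using K degs t gauss_legendre_node[OF gl \<alpha>] unfolding gauss_lipschitz_const_def R_def by auto
    also have "\<dots> \<le> E * R"
      unfolding E_def using K dist R0 by (intro mult_right_mono mult_left_mono) (auto simp: gauss_lipschitz_const_def)
    finally show ?thesis
      unfolding x_def[symmetric] ux power2_eq_square[symmetric] by linarith
  qed
  have "(\<Sum>\<alpha>\<le>k. w \<alpha> / 2 * (c - a) * u (Y (qpt i q \<alpha>)) * u (Y (qpt i q \<alpha>)))
      \<le> (\<Sum>\<alpha>\<le>k. w \<alpha> / 2 * (c - a) * ((poly s (\<xi> \<alpha>))\<^sup>2 + E * R))"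
  proof (intro sum_mono)
    fix \<alpha> assume "\<alpha> \<in> {..k}"
    then show "w \<alpha> / 2 * (c - a) * u (Y (qpt i q \<alpha>)) * u (Y (qpt i q \<alpha>))
        \<le> w \<alpha> / 2 * (c - a) * ((poly s (\<xi> \<alpha>))\<^sup>2 + E * R)"
      unfolding mult.assoc[of "w \<alpha> / 2 * (c - a)"] using pt[of \<alpha>] w[of \<alpha>] ac
      by (intro mult_left_mono mult_nonneg_nonneg) auto
  qed
  also have "\<dots> = (\<Sum>\<alpha>\<le>k. (c - a) / 2 * (w \<alpha> * (poly s (\<xi> \<alpha>))\<^sup>2 + E * R * w \<alpha>))"
    by (intro sum.cong) (auto simp: field_simps)
  also have "\<dots> = (c - a) / 2 * (R + E * R * (\<Sum>\<alpha>\<le>k. w \<alpha>))"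
    by (simp only: R_def sum_distrib_left[symmetric] sum.distrib)
  \<comment> \<open>The weights sum to 2, which gives 1 + 2 E, that is, 1 + 4 K (exp (2 \<rho>) -
    1).\<close>
  also have "\<dots> = (c - a) * (R / 2 * (1 + 2 * E))"
    unfolding gauss_weights_sum by (simp add: field_simps)
  also have "\<dots> \<le> d * exp \<rho> * (R / 2 * (1 + 2 * E))"
    using cad R0 E0 by (intro mult_right_mono) auto
  also have "\<dots> = exp \<rho> * (1 + 4 * K * (exp (2 * \<rho>) - 1)) * (d / 2 * R)"
    by (simp add: E_def algebra_simps)
  finally show ?thesis
    unfolding int[symmetric] a_def c_def .
qed

text \<open>Images of neighbouring subcells, and then of neighbouring cells, share end points, so
  the local integrals are joined twice; Y commutes with the unit shift, so the result is an integral
  over exactly one period.\<close>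

lemma G_stability:
  assumes K: "gauss_lipschitz_const k \<xi> w K" and u: "u \<in> V"
  shows "G (\<lambda>x. u (Y x)) (\<lambda>x. u (Y x)) \<le> exp \<rho> * (1 + 4 * K * (exp (2 * \<rho>) - 1)) * L2_inner u u"
proof -
  let ?c = "exp \<rho> * (1 + 4 * K * (exp (2 * \<rho>) - 1))" and ?f = "\<lambda>x. u x * u x"
  have "periodic1 ?f" using DG_periodic[OF u] by (simp add: periodic1_def)
  note int = periodic1_has_integral[OF this DG_square_has_integral[OF u]]
  have "G (\<lambda>x. u (Y x)) (\<lambda>x. u (Y x)) \<le> (\<Sum>i<M. \<Sum>q\<le>p i. ?c * integral {Y (X i q)..Y (X i (Suc q))} ?f)"
    unfolding G_alt by (intro sum_mono subcell_stability[OF K u]) auto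
  also have "\<dots> = ?c * (\<Sum>i<M. \<Sum>q<Suc (p i). integral {Y (X i q)..Y (X i (Suc q))} ?f)"
    by (simp only: sum_distrib_left lessThan_Suc_atMost)
  also have "(\<Sum>i<M. \<Sum>q<Suc (p i). integral {Y (X i q)..Y (X i (Suc q))} ?f)
      = (\<Sum>i<M. integral {Y (real i / real M)..Y (real (Suc i) / real M)} ?f)"
  proof (intro sum.cong refl)
    fix i
    have "(\<Sum>q<Suc (p i). integral {Y (X i q)..Y (X i (Suc q))} ?f)
        = integral {Y (X i 0)..Y (X i (Suc (p i)))} ?f"
      by (rule sum_integral_adjacent[OF int(1), where X = "\<lambda>q. Y (X i q)"])
        (auto intro!: Y_le less_imp_le[OF breakpoints_step])
    then show "(\<Sum>q<Suc (p i). integral {Y (X i q)..Y (X i (Suc q))} ?f)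
        = integral {Y (real i / real M)..Y (real (Suc i) / real M)} ?f"
      by (simp only: breakpoints_first breakpoints_last)
  qed
  also have "\<dots> = integral {Y (real 0 / real M)..Y (real M / real M)} ?f"
    by (rule sum_integral_adjacent[OF int(1), where X = "\<lambda>i. Y (real i / real M)"])
      (intro Y_le less_imp_le[OF cell_less])
  also have "\<dots> = integral {Y 0..Y 0 + 1} ?f"
    using Y_plus_1[of 0] by simp
  also have "\<dots> = L2_inner u u"
    using int(2) by (rule integral_unique)
  finally show ?thesis .
qed

text \<open>P and P' stand for approximations of the exact solution at the old and the new time.
  Testing with e = U - P', U being the new iterate, turns the L2 products into discrete ones, and
  Cauchy-Schwarz leaves the discrete norms of (u - P) o Y and of the defect P o Y - P'.\<close>

lemma step_error:
  assumes K: "gauss_lipschitz_const k \<xi> w K" and u: "u \<in> V" and P: "P \<in> V" and P': "P' \<in> V"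
    and \<delta>: "\<And>x. \<bar>P (Y x) - P' x\<bar> \<le> \<delta>"
  shows "L2_norm (\<lambda>x. SL_step k \<xi> w y \<tau> M u x - P' x)
    \<le> sqrt (exp \<rho> * (1 + 4 * K * (exp (2 * \<rho>) - 1))) * L2_norm (\<lambda>x. u x - P x) + \<delta>"
proof -
  let ?U = "SL_step k \<xi> w y \<tau> M u" and ?c = "exp \<rho> * (1 + 4 * K * (exp (2 * \<rho>) - 1))"
  define e where "e = (\<lambda>x. ?U x - P' x)"
  define z where "z = (\<lambda>x. u x - P x)"
  have U: "?U \<in> V" by (rule SL_step_DG)
  have e: "e \<in> V" unfolding e_def by (rule DG_diff[OF U P'])
  have z: "z \<in> V" unfolding z_def by (rule DG_diff[OF u P])
  have c: "?c \<ge> 0" using K \<rho> by (simp add: gauss_lipschitz_const_def)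
  have "(L2_norm e)\<^sup>2 = G e e"
    using e by (simp add: L2_inner_self[symmetric] G_DG)
  also have "e = (\<lambda>x. ?U x + (- 1) * P' x)" by (simp add: e_def)
  then have "G e e = G ?U e + (- 1) * G P' e"
    by (simp only: G_add_left G_scale_left)
  also have "\<dots> = G (\<lambda>x. u (Y x)) e + (- 1) * G P' e"
    using G_DG[OF U e] SL_step_DG(2)[OF e] by simp
  also have "\<dots> = G (\<lambda>x. u (Y x) + (- 1) * P' x) e"
    by (simp only: G_add_left G_scale_left)
  also have "\<dots> \<le> Gnorm (\<lambda>x. u (Y x) + (- 1) * P' x) * Gnorm e"
    by (rule G_le_Gnorm)
  also have "(\<lambda>x. u (Y x) + (- 1) * P' x) = (\<lambda>x. z (Y x) + (P (Y x) - P' x))"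
    by (auto simp: z_def)
  also have "Gnorm e = L2_norm e" by (rule Gnorm_DG[OF e])
  finally have "(L2_norm e)\<^sup>2 \<le> Gnorm (\<lambda>x. z (Y x) + (P (Y x) - P' x)) * L2_norm e" .
  \<comment> \<open>One factor \<open>L2_norm e\<close> cancels; if it is zero, the bound is
    trivial.\<close>
  then have "L2_norm e \<le> Gnorm (\<lambda>x. z (Y x) + (P (Y x) - P' x))"
    using L2_norm_nonneg[of e] Gnorm_nonneg[of "\<lambda>x. z (Y x) + (P (Y x) - P' x)"]
    by (cases "L2_norm e = 0") (auto simp: power2_eq_square)
  also have "\<dots> \<le> Gnorm (\<lambda>x. z (Y x)) + Gnorm (\<lambda>x. P (Y x) - P' x)"
    by (rule Gnorm_add)
  also have "Gnorm (\<lambda>x. P (Y x) - P' x) \<le> \<delta>"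
    by (rule Gnorm_bound) (rule \<delta>)
  also have "Gnorm (\<lambda>x. z (Y x)) \<le> sqrt ?c * L2_norm z"
  proof (rule power2_le_imp_le)
    have "(Gnorm (\<lambda>x. z (Y x)))\<^sup>2 \<le> ?c * (L2_norm z)\<^sup>2"
      unfolding Gnorm_square L2_inner_self[OF z, symmetric] by (rule G_stability[OF K z])
    then show "(Gnorm (\<lambda>x. z (Y x)))\<^sup>2 \<le> (sqrt ?c * L2_norm z)\<^sup>2"
      using c by (simp add: power_mult_distrib)
    show "0 \<le> sqrt ?c * L2_norm z" using c L2_norm_nonneg by simp
  qed
  finally show ?thesis by (simp add: e_def z_def)
qed

end

section \<open>The error estimate\<close>

context dg_mesh
begin

text \<open>The bound is stated at every real number, not almost everywhere, because it is evaluated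
  at quadrature points and at the feet of their characteristics.\<close>

lemma DG_approx:
  assumes f: "periodic1 f"
    and approx: "\<And>i. i < M \<Longrightarrow> \<exists>p. degree p \<le> k \<and> (\<forall>x\<in>cell i. \<bar>f x - poly p x\<bar> \<le> \<epsilon>)"
  shows "\<exists>P\<in>V. \<forall>x. \<bar>f x - P x\<bar> \<le> \<epsilon>"
proof -
  have "\<exists>p. \<forall>i. i < M \<longrightarrow> degree (p i) \<le> k \<and> (\<forall>x\<in>cell i. \<bar>f x - poly (p i) x\<bar> \<le> \<epsilon>)"
    using approx by (intro choice) blast
  then obtain p where p: "\<And>i. i < M \<Longrightarrow> degree (p i) \<le> k"
    "\<And>i x. i < M \<Longrightarrow> x \<in> cell i \<Longrightarrow> \<bar>f x - poly (p i) x\<bar> \<le> \<epsilon>"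
    by blast
  have mem: "DG_of p \<in> V" by (rule DG_of_mem) (rule p(1))
  have "\<bar>f x - DG_of p x\<bar> \<le> \<epsilon>" for x
  proof -
    have "frac x \<in> {0..<1}" by (simp add: frac_lt_1)
    then obtain i where i: "i < M" "frac x \<in> cell i"
      using unit_interval_cell[OF M] by blast
    have "g (frac x) = g x" if "periodic1 g" for g
      using periodic1_of_int[OF that, of "frac x" "\<lfloor>x\<rfloor>"] by (simp add: frac_def)
    from this[OF f] this[OF DG_periodic[OF mem]] p(2)[OF i] DG_of_cell[OF i, of p]
    show ?thesis by simp
  qed
  with mem show ?thesis by blast
qed

lemma DG_minus_continuous_integrable:
  assumes u: "u \<in> V" and f: "continuous_on UNIV f"
  shows "set_integrable lborel {0<..<1} (\<lambda>x. (u x - f x) * (u x - f x))"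
proof -
  obtain p where p: "\<And>i x. i < M \<Longrightarrow> x \<in> cell i \<Longrightarrow> u x = poly (p i) x"
    using DG_polys[OF u] by metis
  show ?thesis
    by (rule piecewise_set_integrable[OF M, of "\<lambda>i x. (poly (p i) x - f x) * (poly (p i) x - f x)"])
      (auto simp: p intro!: continuous_intros f)
qed

text \<open>A triangle inequality with the factor sqrt 2 that comes from (a + b)^2 <= 2 a^2 + 2 b^2.
  The factor is harmless because the lemma serves the initial and the final time and stays outside
  the iteration.\<close>

lemma L2_norm_perturb:
  assumes f: "set_integrable lborel {0<..<1} (\<lambda>x. f x * f x)"
    and h: "set_integrable lborel {0<..<1} (\<lambda>x. h x * h x)"
    and le: "\<And>x. \<bar>h x\<bar> \<le> \<bar>f x\<bar> + \<epsilon>"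
  shows "L2_norm h \<le> sqrt 2 * (L2_norm f + \<bar>\<epsilon>\<bar>)"
proof -
  have const: "set_integrable lborel {0<..<1::real} (\<lambda>x. 2 * (\<epsilon> * \<epsilon>))"
    by (simp add: set_integrable_def)
  have f2: "set_integrable lborel {0<..<1} (\<lambda>x. 2 * (f x * f x))"
    using f by (rule set_integrable_mult_right)
  have "L2_inner h h \<le> (LINT x:{0<..<1}|lborel. 2 * (f x * f x) + 2 * (\<epsilon> * \<epsilon>))"
    unfolding L2_inner_def
  proof (rule set_integral_mono[OF h set_integral_add(1)[OF f2 const]])
    fix x
    have "\<bar>h x\<bar>\<^sup>2 \<le> (\<bar>f x\<bar> + \<epsilon>)\<^sup>2" using le[of x] by (intro power_mono) auto
    also have "\<dots> \<le> 2 * (f x * f x) + 2 * (\<epsilon> * \<epsilon>)"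
      using sum_squares_bound[of "\<bar>f x\<bar>" \<epsilon>] by (simp add: power2_sum flip: power2_eq_square)
    finally show "h x * h x \<le> 2 * (f x * f x) + 2 * (\<epsilon> * \<epsilon>)" by (simp add: power2_eq_square)
  qed
  also have "\<dots> = 2 * L2_inner f f + 2 * (\<epsilon> * \<epsilon>)"
    unfolding set_integral_add(2)[OF f2 const] L2_inner_def by (simp add: set_lebesgue_integral_def)
  also have "L2_inner f f = (L2_norm f)\<^sup>2"
  proof -
    have "L2_inner f f \<ge> 0"
      unfolding L2_inner_def set_lebesgue_integral_def
      by (intro Bochner_Integration.integral_nonneg) auto
    then show ?thesis by (simp add: L2_norm_def)
  qed
  also have "2 * (L2_norm f)\<^sup>2 + 2 * (\<epsilon> * \<epsilon>) \<le> (sqrt 2 * (L2_norm f + \<bar>\<epsilon>\<bar>))\<^sup>2"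
    using L2_norm_nonneg[of f] by (simp add: power_mult_distrib power2_sum flip: power2_eq_square)
  finally have "L2_inner h h \<le> (sqrt 2 * (L2_norm f + \<bar>\<epsilon>\<bar>))\<^sup>2" .
  then have "sqrt (L2_inner h h) \<le> \<bar>sqrt 2 * (L2_norm f + \<bar>\<epsilon>\<bar>)\<bar>"
    by (metis real_sqrt_abs real_sqrt_le_mono)
  moreover have "0 \<le> sqrt 2 * (L2_norm f + \<bar>\<epsilon>\<bar>)" using L2_norm_nonneg[of f] by simp
  ultimately show ?thesis unfolding L2_norm_def[of h] by linarith
qed

end

section \<open>Iteration over the time steps and the constants\<close>

text \<open>As A >= 1, every source term may be enlarged by the full power of A reached so far,
  which keeps the bound in product form.\<close>

lemma discrete_gronwall:
  fixes \<theta> :: "nat \<Rightarrow> real"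
  assumes step: "\<And>n. n < N \<Longrightarrow> \<theta> (Suc n) \<le> A * \<theta> n + \<delta>" and "A \<ge> 1" "\<delta> \<ge> 0"
  shows "n \<le> N \<Longrightarrow> \<theta> n \<le> A ^ n * (\<theta> 0 + real n * \<delta>)"
proof (induction n)
  case (Suc n)
  have "\<theta> (Suc n) \<le> A * \<theta> n + \<delta>" using Suc.prems by (intro step) simp
  also have "\<dots> \<le> A * (A ^ n * (\<theta> 0 + real n * \<delta>)) + A ^ Suc n * \<delta>"
    using Suc assms(2,3) mult_right_mono[OF one_le_power[OF assms(2), of "Suc n"] assms(3)]
    by (intro add_mono mult_left_mono) auto
  also have "\<dots> = A ^ Suc n * (\<theta> 0 + real (Suc n) * \<delta>)" by (simp add: algebra_simps)
  finally show ?case .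
qed simp

text \<open>Combines exp r - 1 <= r exp r for r = 2 L \<tau> with 1 + x <= exp x. The square root,
  which leads from squared norms to norms, halves the rate; bounding exp r by exp (2 L T) keeps that
  rate independent of \<tau>.\<close>

lemma stability_const_le:
  fixes L K \<tau> T :: real
  assumes "L \<ge> 0" "K \<ge> 0" "0 \<le> \<tau>" "\<tau> \<le> T"
  shows "sqrt (exp (L * \<tau>) * (1 + 4 * K * (exp (2 * (L * \<tau>)) - 1)))
    \<le> exp ((L + 8 * K * L * exp (2 * L * T)) / 2 * \<tau>)"
proof -
  define r where "r = 2 * (L * \<tau>)"
  have "r \<ge> 0" using assms by (simp add: r_def)
  have "1 - exp (- r) \<le> r" using exp_ge_add_one_self[of "- r"] by linarith
  then have "(1 - exp (- r)) * exp r \<le> r * exp r" by (intro mult_right_mono) auto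
  also have "(1 - exp (- r)) * exp r = exp r - 1" by (simp add: left_diff_distrib flip: exp_add)
  also have "r * exp r \<le> r * exp (2 * L * T)"
    using assms \<open>r \<ge> 0\<close> by (intro mult_left_mono) (auto simp: r_def mult_left_mono mult.assoc)
  finally have "4 * K * (exp r - 1) \<le> 4 * K * (r * exp (2 * L * T))"
    using assms by (intro mult_left_mono) auto
  then have "1 + 4 * K * (exp r - 1) \<le> exp (4 * K * (r * exp (2 * L * T)))"
    using exp_ge_add_one_self[of "4 * K * (r * exp (2 * L * T))"] by linarith
  then have "exp (L * \<tau>) * (1 + 4 * K * (exp r - 1)) \<le> exp (L * \<tau>) * exp (4 * K * (r * exp (2 * L * T)))"
    by (intro mult_left_mono) auto
  also have "\<dots> = (exp ((L + 8 * K * L * exp (2 * L * T)) / 2 * \<tau>))\<^sup>2"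
    by (simp add: r_def power2_eq_square algebra_simps flip: exp_add)
  finally show ?thesis
    unfolding r_def by (metis abs_exp_cancel real_sqrt_abs real_sqrt_le_mono)
qed

text \<open>Reduces the estimate to cellwise polynomial approximation of v t within \<epsilon>,
  uniformly in t.\<close>

lemma SLDG_error:
  fixes y v :: "real \<Rightarrow> real \<Rightarrow> real"
  assumes flow: "lipschitz_flow b b' y L" and "L \<ge> 0" and per: "periodic1 b"
    and v: "transport_solution b v0 T v" and v0: "continuous_on UNIV v0"
    and gl: "gauss_legendre k \<xi> w" and K: "gauss_lipschitz_const k \<xi> w K"
    and T: "T > 0" and N: "N \<ge> 1" and M: "M \<ge> 1" and \<epsilon>: "\<epsilon> \<ge> 0"
    and approx: "\<And>t i. t \<in> {0..T} \<Longrightarrow> i < M \<Longrightarrow> \<exists>p. degree p \<le> k \<and>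
      (\<forall>x\<in>{real i / real M..<real (Suc i) / real M}. \<bar>v t x - poly p x\<bar> \<le> \<epsilon>)"
    and n: "n \<le> N"
  defines "\<tau> \<equiv> T / real N" and "\<sigma> \<equiv> (L + 8 * K * L * exp (2 * L * T)) / 2"
  defines "u \<equiv> SLDG_scheme k \<xi> w y \<tau> M v0"
  shows "L2_norm (\<lambda>x. u n x - v (real n * \<tau>) x)
    \<le> 2 * exp (\<sigma> * T) * (L2_norm (\<lambda>x. v 0 x - u 0 x) + 4 * real N * \<epsilon>)"
proof -
  interpret lipschitz_flow b b' y L by (rule flow)
  interpret dg_mesh k \<xi> w M using gl M by unfold_locales
  have \<tau>: "\<tau> > 0" "\<tau> \<le> T" "real N * \<tau> = T"
    using T N by (auto simp: \<tau>_def field_simps)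
  have time: "real m * \<tau> \<in> {0..T}" if "m \<le> N" for m
    using that \<tau> mult_right_mono[of "real m" "real N" \<tau>] by simp
  interpret dg_step k \<xi> w M y \<tau> "L * \<tau>"
  proof
    show "0 \<le> L * \<tau>" using \<open>L \<ge> 0\<close> \<tau> by simp
    show "(z - x) * exp (- (L * \<tau>)) \<le> y z (- \<tau>) - y x (- \<tau>)" if "x \<le> z" for x z
      using y_diff_ge[OF that, of "- \<tau>"] \<tau> by simp
    show "y z (- \<tau>) - y x (- \<tau>) \<le> (z - x) * exp (L * \<tau>)" if "x \<le> z" for x z
      using y_diff_le[OF that, of "- \<tau>"] \<tau> by simp
    show "continuous_on UNIV (\<lambda>x. y x (- \<tau>))"
      by (intro y_continuous_compose continuous_intros)
    show "y (x + 1) (- \<tau>) = y x (- \<tau>) + 1" for x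
      by (rule y_plus_1[OF per])
  qed
  have v_eq: "v t = (\<lambda>x. v0 (y x (- t)))" if "t \<in> {0..T}" for t
  proof
    fix x
    show "v t x = v0 (y x (- t))"
      using transport_solution_along[OF v _ that, of 0 x] v T by (simp add: transport_solution_def)
  qed
  have v_cont: "continuous_on UNIV (v t)" if "t \<in> {0..T}" for t
    unfolding v_eq[OF that]
    by (rule continuous_on_compose2[OF v0]) (auto intro!: y_continuous_compose continuous_intros)
  have "\<exists>P\<in>V. \<forall>x. \<bar>v t x - P x\<bar> \<le> \<epsilon>" if "t \<in> {0..T}" for t
    using v that by (intro DG_approx approx) (auto simp: transport_solution_def)
  then have "\<exists>P. \<forall>m. m \<le> N \<longrightarrow> P m \<in> V \<and> (\<forall>x. \<bar>v (real m * \<tau>) x - P m x\<bar> \<le> \<epsilon>)"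
    using time by (intro choice) blast
  then obtain P where P: "\<And>m. m \<le> N \<Longrightarrow> P m \<in> V"
    "\<And>m x. m \<le> N \<Longrightarrow> \<bar>v (real m * \<tau>) x - P m x\<bar> \<le> \<epsilon>"
    by blast
  have u_Suc: "u (Suc m) = SL_step k \<xi> w y \<tau> M (u m)" for m
    by (simp add: u_def SLDG_scheme_def)
  have uV: "u m \<in> V" for m
  proof (cases m)
    case 0
    then show ?thesis using DG_proj_mem[OF v0] by (simp add: u_def SLDG_scheme_def)
  next
    case (Suc l)
    then show ?thesis using SL_step_DG(1) u_Suc by simp
  qed
  define \<theta> where "\<theta> m = L2_norm (\<lambda>x. u m x - P m x)" for m
  define A where "A = exp (\<sigma> * \<tau>)"
  have "\<sigma> \<ge> 0" using \<open>L \<ge> 0\<close> K by (simp add: \<sigma>_def gauss_lipschitz_const_def)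
  have "\<theta> (Suc m) \<le> A * \<theta> m + 2 * \<epsilon>" if m: "m < N" for m
  proof -
    have "\<bar>P m (Y x) - P (Suc m) x\<bar> \<le> 2 * \<epsilon>" for x
    proof -
      have "real m * \<tau> - real (Suc m) * \<tau> = - \<tau>" by (simp add: algebra_simps)
      then have "v (real m * \<tau>) (Y x) = v (real (Suc m) * \<tau>) x"
        using transport_solution_along[OF v time time, of m "Suc m" x] m by simp
      with P(2)[of m "Y x"] P(2)[of "Suc m" x] m show ?thesis by simp
    qed
    from step_error[OF K uV[of m] P(1)[of m] P(1)[of "Suc m"] this] m
    have "\<theta> (Suc m) \<le> sqrt (exp (L * \<tau>) * (1 + 4 * K * (exp (2 * (L * \<tau>)) - 1))) * \<theta> m + 2 * \<epsilon>"
      by (simp add: \<theta>_def u_Suc)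
    also have "\<dots> \<le> A * \<theta> m + 2 * \<epsilon>"
      unfolding A_def \<sigma>_def using \<open>L \<ge> 0\<close> K \<tau> L2_norm_nonneg
      by (intro add_right_mono mult_right_mono stability_const_le)
        (auto simp: \<theta>_def gauss_lipschitz_const_def)
    finally show ?thesis .
  qed
  moreover have "A \<ge> 1" using \<open>\<sigma> \<ge> 0\<close> \<tau> by (simp add: A_def)
  ultimately have "\<theta> n \<le> A ^ n * (\<theta> 0 + real n * (2 * \<epsilon>))"
    by (rule discrete_gronwall) (use \<epsilon> n in auto)
  also have "\<dots> \<le> exp (\<sigma> * T) * (\<theta> 0 + real N * (2 * \<epsilon>))"
  proof (intro mult_mono add_mono)
    have "A ^ n = exp (\<sigma> * (real n * \<tau>))" by (simp add: A_def exp_of_nat_mult[symmetric] mult_ac)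
    also have "\<dots> \<le> exp (\<sigma> * T)" using \<open>\<sigma> \<ge> 0\<close> time[OF n] by (simp add: mult_left_mono)
    finally show "A ^ n \<le> exp (\<sigma> * T)" .
  qed (use n \<epsilon> L2_norm_nonneg in \<open>auto simp: \<theta>_def\<close>)
  finally have \<theta>: "\<theta> n \<le> exp (\<sigma> * T) * (\<theta> 0 + real N * (2 * \<epsilon>))" .
  have int: "set_integrable lborel {0<..<1} (\<lambda>x. (g x - f x) * (g x - f x))"
    if "g \<in> V" "f = (\<lambda>x. 0) \<or> (\<exists>t\<in>{0..T}. f = v t)" for g f
    using that by (intro DG_minus_continuous_integrable) (auto intro: v_cont)
  have err: "L2_norm (\<lambda>x. u n x - v (real n * \<tau>) x) \<le> sqrt 2 * (\<theta> n + \<bar>\<epsilon>\<bar>)"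
    unfolding \<theta>_def
  proof (rule L2_norm_perturb)
    show "set_integrable lborel {0<..<1} (\<lambda>x. (u n x - P n x) * (u n x - P n x))"
      using int[OF DG_diff[OF uV P(1)[OF n]], of "\<lambda>x. 0"] by simp
    show "set_integrable lborel {0<..<1}
        (\<lambda>x. (u n x - v (real n * \<tau>) x) * (u n x - v (real n * \<tau>) x))"
      using time[OF n] by (intro int uV) blast
    show "\<bar>u n x - v (real n * \<tau>) x\<bar> \<le> \<bar>u n x - P n x\<bar> + \<epsilon>" for x
      using P(2)[OF n, of x] by linarith
  qed
  have start: "\<theta> 0 \<le> sqrt 2 * (L2_norm (\<lambda>x. v 0 x - u 0 x) + \<bar>\<epsilon>\<bar>)"
    unfolding \<theta>_def
  proof (rule L2_norm_perturb)
    show "set_integrable lborel {0<..<1} (\<lambda>x. (u 0 x - P 0 x) * (u 0 x - P 0 x))"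
      using int[OF DG_diff[OF uV P(1)[of 0]], of "\<lambda>x. 0"] by simp
    have "(\<lambda>x. (v 0 x - u 0 x) * (v 0 x - u 0 x)) = (\<lambda>x. (u 0 x - v 0 x) * (u 0 x - v 0 x))"
      by (auto simp: algebra_simps)
    moreover have "\<exists>t\<in>{0..T}. v 0 = v t" using T by (intro bexI[of _ 0]) auto
    ultimately show "set_integrable lborel {0<..<1} (\<lambda>x. (v 0 x - u 0 x) * (v 0 x - u 0 x))"
      using int[OF uV[of 0], of "v 0"] by simp
    show "\<bar>u 0 x - P 0 x\<bar> \<le> \<bar>v 0 x - u 0 x\<bar> + \<epsilon>" for x
      using P(2)[of 0 x] by simp
  qed
  define D where "D = L2_norm (\<lambda>x. v 0 x - u 0 x)"
  define F where "F = exp (\<sigma> * T)"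
  have D0: "D \<ge> 0" by (simp add: D_def L2_norm_nonneg)
  have F1: "F \<ge> 1" using \<open>\<sigma> \<ge> 0\<close> T by (simp add: F_def)
  have s2: "sqrt 2 \<le> 2" "1 \<le> sqrt 2" by (auto simp: real_le_lsqrt)
  \<comment> \<open>With N >= 1, the approximation errors at the two ends of the time interval are
    absorbed into 4 N \<epsilon>.\<close>
  have N\<epsilon>: "\<epsilon> \<le> real N * \<epsilon>" using N \<epsilon> mult_right_mono[of 1 "real N" \<epsilon>] by simp
  have "L2_norm (\<lambda>x. u n x - v (real n * \<tau>) x) \<le> sqrt 2 * (F * (\<theta> 0 + real N * (2 * \<epsilon>)) + \<epsilon>)"
    using err \<theta> \<epsilon> s2 by (auto simp: F_def intro: order_trans)
  also have "\<dots> \<le> sqrt 2 * (F * (\<theta> 0 + real N * (2 * \<epsilon>)) + F * \<epsilon>)"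
    using F1 \<epsilon> mult_right_mono[OF F1 \<epsilon>] by simp
  also have "\<dots> = F * (sqrt 2 * \<theta> 0 + sqrt 2 * (real N * (2 * \<epsilon>) + \<epsilon>))"
    by (simp add: algebra_simps)
  also have "\<dots> \<le> F * (2 * (D + \<epsilon>) + 2 * (real N * (2 * \<epsilon>) + \<epsilon>))"
  proof (intro mult_left_mono add_mono)
    have "sqrt 2 * \<theta> 0 \<le> sqrt 2 * (sqrt 2 * (D + \<epsilon>))"
      using start \<epsilon> by (simp add: D_def)
    also have "\<dots> = 2 * (D + \<epsilon>)" by (simp flip: mult.assoc)
    finally show "sqrt 2 * \<theta> 0 \<le> 2 * (D + \<epsilon>)" .
    show "sqrt 2 * (real N * (2 * \<epsilon>) + \<epsilon>) \<le> 2 * (real N * (2 * \<epsilon>) + \<epsilon>)"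
      using s2 \<epsilon> by (intro mult_right_mono) auto
  qed (use F1 in auto)
  also have "\<dots> = 2 * F * (D + (2 * \<epsilon> + 2 * real N * \<epsilon>))" by (simp add: algebra_simps)
  also have "\<dots> \<le> 2 * F * (D + 4 * real N * \<epsilon>)"
  proof (intro mult_left_mono add_left_mono)
    show "2 * \<epsilon> + 2 * real N * \<epsilon> \<le> 4 * real N * \<epsilon>" using N\<epsilon> by linarith
  qed (use F1 in auto)
  finally show ?thesis by (simp add: D_def F_def)
qed

theorem theorem2p2:
  fixes k :: nat and T :: real
    and b v0 :: "real \<Rightarrow> real"
    and y v :: "real \<Rightarrow> real \<Rightarrow> real"
    and \<xi> w :: "nat \<Rightarrow> real"
  assumes "T > 0"
    and "periodic1 v0" and "C_class (k + 1) v0"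
    and "periodic1 b" and "C_class (2 * k + 2) b"
    and "characteristics b y"
    and "transport_solution b v0 T v"
    and "gauss_legendre k \<xi> w"
  shows "\<exists>C1 C :: real. C1 \<ge> 0 \<and> C \<ge> 0 \<and>
    (\<forall>N M :: nat. N \<ge> 1 \<longrightarrow> M \<ge> 1 \<longrightarrow>
      (let \<Delta>t = T / real N; \<Delta>x = 1 / real M;
           u = SLDG_scheme k \<xi> w y \<Delta>t M v0
       in \<forall>n\<le>N.
            L2_norm (\<lambda>x. u n x - v (real n * \<Delta>t) x)
              \<le> exp (C1 * T) *
                 (L2_norm (\<lambda>x. v 0 x - u 0 x) + C * T * (\<Delta>x ^ (k + 1) / \<Delta>t))))"
proof -
  have b: "C_class (Suc (2 * k + 1)) b" using assms(5) by simp
  have b': "C_class (2 * k + 1) (deriv b)" by (rule C_class_Suc(2)[OF b])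
  have b'_cont: "continuous_on UNIV (deriv b)" by (rule C_class_continuous[OF b'])
  obtain L where L: "\<And>x. \<bar>deriv b x\<bar> \<le> L"
    using periodic1_bounded[OF periodic1_deriv[OF assms(4)] b'_cont] by blast
  have "L \<ge> 0" using L[of 0] by linarith
  interpret lipschitz_flow b "deriv b" y L
  proof
    show "(b has_real_derivative deriv b x) (at x)" for x by (rule C_class_DERIV[OF b])
  qed (rule b'_cont L assms(6))+
  have "param_C (Suc k) (\<lambda>t x. v0 (y x t))"
    by (rule param_C_compose[OF _ param_C_flow[OF C_class_mono[OF b']]]) (use assms(3) in simp_all)
  \<comment> \<open>The solution at time t is v0 composed with the flow at time -t, so the parameter
    ranges over [-T, 0].\<close>
  from param_C_local_polynomial[OF this, of "- T" 0] obtain B where "B \<ge> 0" and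
    B: "\<And>t c. t \<in> {- T..0} \<Longrightarrow> c \<in> {0..1} \<Longrightarrow> \<exists>p. degree p \<le> k \<and> (\<forall>x\<in>{0..1}.
           \<bar>v0 (y x t) - poly p x\<bar> \<le> B * \<bar>x - c\<bar> ^ Suc k)"
    by blast
  obtain K where K: "gauss_lipschitz_const k \<xi> w K"
    using gauss_square_lipschitz[OF assms(8)] unfolding gauss_lipschitz_const_def by blast
  define \<sigma> where "\<sigma> = (L + 8 * K * L * exp (2 * L * T)) / 2"
  have "\<sigma> \<ge> 0" using \<open>L \<ge> 0\<close> K by (simp add: \<sigma>_def gauss_lipschitz_const_def)
  \<comment> \<open>The summand ln 2 / T makes exp (C1 T) absorb the factor 2 of
    \<open>SLDG_error\<close>.\<close>
  define C1 where "C1 = \<sigma> + ln 2 / T"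
  have "C1 \<ge> 0" using \<open>\<sigma> \<ge> 0\<close> assms(1) by (simp add: C1_def)
  have C1: "exp (C1 * T) = 2 * exp (\<sigma> * T)"
    using assms(1) by (simp add: C1_def distrib_right exp_add)
  have main: "L2_norm (\<lambda>x. SLDG_scheme k \<xi> w y (T / real N) M v0 n x - v (real n * (T / real N)) x)
      \<le> exp (C1 * T) * (L2_norm (\<lambda>x. v 0 x - SLDG_scheme k \<xi> w y (T / real N) M v0 0 x)
        + (4 * B) * T * ((1 / real M) ^ (k + 1) / (T / real N)))"
    if N: "N \<ge> 1" and M: "M \<ge> 1" and n: "n \<le> N" for N M n
  proof -
    define \<epsilon> where "\<epsilon> = B * (1 / real M) ^ Suc k"
    have \<epsilon>: "\<epsilon> \<ge> 0" using \<open>B \<ge> 0\<close> by (simp add: \<epsilon>_def)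
    have "\<exists>p. degree p \<le> k \<and>
        (\<forall>x\<in>{real i / real M..<real (Suc i) / real M}. \<bar>v t x - poly p x\<bar> \<le> \<epsilon>)"
      if t: "t \<in> {0..T}" and i: "i < M" for t i
    proof -
      have "real (Suc i) / real M \<le> 1" using i by simp
      \<comment> \<open>The Taylor expansion is centred at the left end of the cell, so |x - c| is
        at most the mesh width.\<close>
      have c: "real i / real M \<in> {0..1}" using i by simp
      obtain p where p: "degree p \<le> k" "\<And>x. x \<in> {0..1} \<Longrightarrow>
          \<bar>v0 (y x (- t)) - poly p x\<bar> \<le> B * \<bar>x - real i / real M\<bar> ^ Suc k"
        using B[of "- t", OF _ c] t by auto
      have "\<bar>v t x - poly p x\<bar> \<le> \<epsilon>" if x: "x \<in> {real i / real M..<real (Suc i) / real M}" for x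
      proof -
        have "v t x = v0 (y x (- t))"
          using transport_solution_along[OF assms(7) _ t, of 0 x] assms(1,7)
          by (simp add: transport_solution_def)
        moreover have "0 \<le> real i / real M" by simp
        then have "x \<in> {0..1}"
          using x \<open>real (Suc i) / real M \<le> 1\<close> unfolding atLeastLessThan_iff atLeastAtMost_iff by linarith
        moreover have "\<bar>x - real i / real M\<bar> \<le> 1 / real M"
          using x by (simp add: add_divide_distrib)
        then have "B * \<bar>x - real i / real M\<bar> ^ Suc k \<le> \<epsilon>"
          unfolding \<epsilon>_def using \<open>B \<ge> 0\<close> by (intro mult_left_mono power_mono) auto
        ultimately show ?thesis using p(2)[of x] by simp
      qed
      then show ?thesis using p(1) by blast
    qed
    from SLDG_error[OF lipschitz_flow_axioms \<open>L \<ge> 0\<close> assms(4,7) C_class_continuous[OF assms(3)]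
        assms(8) K assms(1) N M \<epsilon> this n, folded \<sigma>_def C1]
    \<comment> \<open>Since N is T divided by the time step, 4 N \<epsilon> becomes 4 B T dx^(k+1) /
      dt.\<close>
    show ?thesis
      using assms(1) N by (simp add: \<epsilon>_def mult_ac)
  qed
  show ?thesis
    unfolding Let_def using \<open>C1 \<ge> 0\<close> \<open>B \<ge> 0\<close> main
    by (intro exI[of _ C1] exI[of _ "4 * B"]) simp
qed

end
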